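(* Let $\mu\in\mathbb R$, $\mathcal E_\mu=\mathcal E-\mu\mathbf 1$, and assume $\mathcal E_\mu>0$. Then the integral $$\int d\mu_{\mathbf V}(h)\int_{\mathbb C^{\mathbb X_T}}\mathcal Da\;e^{-(\bar a,\mathcal K(h)a)_{\mathbb X_T}}$$ is absolutely convergent. The grand-canonical covariance $\mathcal G(h)=\mathcal K(h)^{-1}$ exists for all real $h$, and its norm is bounded uniformly in $h$. It is analytic in $h$ on the set where $|\mathrm{Im}\,h_{j,x}|<\sqrt\epsilon\,e_{\min}$ for all $(j,x)$, where $e_{\min}$ is the smallest eigenvalue of $\mathcal E_\mu$. If $\mathcal E_\mu$ generates a stochastic process, then for all $j'\ge j$, all $x,x'\in\Lambda$ and all real $h$, $$\big|\mathcal G(h)_{(j,x),(j',x')}\big|\le\mathcal G(0)_{(j,x),(j',x')} .$$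
   Context: $\Lambda$ finite discrete torus $\mathbb Z^d/L\mathbb Z^d$ (spacing $1$, $(f,g)_\Lambda=\sum_xf_xg_x$); operators on $\mathbb C^\Lambda$ are matrices; functions on $\Lambda$ act as multiplication operators. $\mathcal E$ hermitian, $v$ real symmetric with $v\ge0$ (standing assumption). $\beta>0$, $n_\tau\in\mathbb N$, $\epsilon=\beta/n_\tau$, $\mathbb X_T=\{0,\dots,n_\tau\}\times\Lambda$, $a=(a_j)_{j=0}^{n_\tau}$, $a_j\in\mathbb C^\Lambda$, $\mathcal Da=\prod_{j,x}\frac{d\bar a_{j,x}\wedge da_{j,x}}{2\pi i}$. $h=(h_j)_{j=1}^{n_\tau}$, $h_j\in\mathbb R^\Lambda$ (complexified for the analyticity statement), $h_0=0$; $\mu_v$ the centered Gaussian probability measure on $\mathbb R^\Lambda$ with covariance $v$, $d\mu_{\mathbf V}(h)=\prod_{j=1}^{n_\tau}d\mu_v(h_j)$. $\mathcal K(h)$ is the block matrix indexed by $j,j'\in\{0,\dots,n_\tau\}$ with $\mathcal K(h)_{j,j'}=\delta_{j,j'}\mathbf 1-\delta_{j+1,j'}e^{-\epsilon\mathcal E_\mu}e^{i\sqrt\epsilon h_{j'}}-\delta_{j,n_\tau}\delta_{0,j'}\mathbf 1$, and $(\bar a,\mathcal K(h)a)_{\mathbb X_T}=\sum_{j,j'}(\bar a_j,\mathcal K(h)_{j,j'}a_{j'})_\Lambda$. An operator $T$ generates a stochastic process if $(e^{-\tau T})_{x,y}\ge0$ for all $\tau\ge0$, $x,y$. *)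

theory Defs
  imports "HOL-Probability.Probability"
begin

text \<open>Operators on C^Lambda, Lambda a finite index type 'x, are matrices 'x => 'x => complex.\<close>

type_synonym 'x cmat = "'x \<Rightarrow> 'x \<Rightarrow> complex"

definition mmult :: "('x::finite) cmat \<Rightarrow> 'x cmat \<Rightarrow> 'x cmat" where
  "mmult A B = (\<lambda>x y. \<Sum>z\<in>UNIV. A x z * B z y)"

definition mid :: "('x::finite) cmat" where
  "mid = (\<lambda>x y. if x = y then 1 else 0)"

definition mpow :: "('x::finite) cmat \<Rightarrow> nat \<Rightarrow> 'x cmat" where
  "mpow A k = ((mmult A) ^^ k) mid"

definition mexp :: "('x::finite) cmat \<Rightarrow> 'x cmat" where
  "mexp A = (\<lambda>x y. \<Sum>k. mpow A k x y / of_nat (fact k))"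

definition mscale :: "complex \<Rightarrow> ('x::finite) cmat \<Rightarrow> 'x cmat" where
  "mscale c A = (\<lambda>x y. c * A x y)"

definition hermitian :: "('x::finite) cmat \<Rightarrow> bool" where
  "hermitian A \<longleftrightarrow> (\<forall>x y. A x y = cnj (A y x))"

definition Emu :: "('x::finite) cmat \<Rightarrow> real \<Rightarrow> 'x cmat" where
  "Emu E mu = (\<lambda>x y. E x y - (if x = y then complex_of_real mu else 0))"

text \<open>A > 0 (positive definite, for hermitian A the quadratic form is real).\<close>
definition pos_def :: "('x::finite) cmat \<Rightarrow> bool" where
  "pos_def A \<longleftrightarrow> hermitian A \<and>
     (\<forall>f::'x \<Rightarrow> complex. f \<noteq> (\<lambda>_. 0) \<longrightarrow> 0 < Re (\<Sum>x\<in>UNIV. \<Sum>y\<in>UNIV. cnj (f x) * A x y * f y))"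

definition is_eigenvalue :: "('x::finite) cmat \<Rightarrow> complex \<Rightarrow> bool" where
  "is_eigenvalue A l \<longleftrightarrow> (\<exists>f::'x \<Rightarrow> complex. f \<noteq> (\<lambda>_. 0) \<and> (\<forall>x. (\<Sum>y\<in>UNIV. A x y * f y) = l * f x))"

text \<open>Smallest eigenvalue of a hermitian matrix (all eigenvalues are real).\<close>
definition e_min :: "('x::finite) cmat \<Rightarrow> real" where
  "e_min A = Min {r::real. is_eigenvalue A (complex_of_real r)}"

definition generates_stochastic :: "('x::finite) cmat \<Rightarrow> bool" where
  "generates_stochastic T \<longleftrightarrow>
     (\<forall>\<tau>::real. \<tau> \<ge> 0 \<longrightarrow> (\<forall>x y. mexp (mscale (- complex_of_real \<tau>) T) x y \<in> \<real>
                                    \<and> 0 \<le> Re (mexp (mscale (- complex_of_real \<tau>) T) x y)))"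

text \<open>Centered Gaussian probability measure on R^Lambda with covariance v,
  characterised by its characteristic function (allows degenerate v).\<close>
definition centered_gaussian :: "('x::finite \<Rightarrow> 'x \<Rightarrow> real) \<Rightarrow> ('x \<Rightarrow> real) measure \<Rightarrow> bool" where
  "centered_gaussian v M \<longleftrightarrow> prob_space M \<and> sets M = sets (PiM UNIV (\<lambda>_. borel)) \<and>
     (\<forall>\<xi>::'x \<Rightarrow> real. (\<integral>h. exp (\<i> * complex_of_real (\<Sum>x\<in>UNIV. \<xi> x * h x)) \<partial>M)
          = exp (- complex_of_real ((\<Sum>x\<in>UNIV. \<Sum>y\<in>UNIV. \<xi> x * v x y * \<xi> y) / 2)))"

definition XT :: "nat \<Rightarrow> (nat \<times> ('x::finite)) set" where
  "XT n\<tau> = {0..n\<tau>} \<times> UNIV"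

text \<open>The block matrix K(h), for complex h = (h_j)_{j=1..n_tau}, h_j in C^Lambda;
  here Emuv stands for E_mu and eps for epsilon.\<close>
definition Kmat :: "nat \<Rightarrow> real \<Rightarrow> ('x::finite) cmat \<Rightarrow> (nat \<Rightarrow> 'x \<Rightarrow> complex)
                     \<Rightarrow> (nat \<times> 'x) \<Rightarrow> (nat \<times> 'x) \<Rightarrow> complex" where
  "Kmat n\<tau> eps Emuv h = (\<lambda>(j, x) (j', x').
      (if j = j' \<and> x = x' then 1 else 0)
    - (if j' = j + 1 then mexp (mscale (- complex_of_real eps) Emuv) x x'
                          * exp (\<i> * complex_of_real (sqrt eps) * h j' x') else 0)
    - (if j = n\<tau> \<and> j' = 0 \<and> x = x' then 1 else 0))"

definition quadform :: "'p set \<Rightarrow> ('p \<Rightarrow> 'p \<Rightarrow> complex) \<Rightarrow> ('p \<Rightarrow> complex) \<Rightarrow> complex" where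
  "quadform S M a = (\<Sum>p\<in>S. \<Sum>q\<in>S. cnj (a p) * M p q * a q)"

definition inverse_on :: "'p set \<Rightarrow> ('p \<Rightarrow> 'p \<Rightarrow> complex) \<Rightarrow> ('p \<Rightarrow> 'p \<Rightarrow> complex) \<Rightarrow> bool" where
  "inverse_on S M N \<longleftrightarrow>
     (\<forall>p\<in>S. \<forall>q\<in>S. (\<Sum>r\<in>S. M p r * N r q) = (if p = q then 1 else 0)) \<and>
     (\<forall>p\<in>S. \<forall>q\<in>S. (\<Sum>r\<in>S. N p r * M r q) = (if p = q then 1 else 0)) \<and>
     (\<forall>p q. p \<notin> S \<or> q \<notin> S \<longrightarrow> N p q = 0)"

definition invertible_on :: "'p set \<Rightarrow> ('p \<Rightarrow> 'p \<Rightarrow> complex) \<Rightarrow> bool" where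
  "invertible_on S M \<longleftrightarrow> (\<exists>N. inverse_on S M N)"

definition inv_on :: "'p set \<Rightarrow> ('p \<Rightarrow> 'p \<Rightarrow> complex) \<Rightarrow> ('p \<Rightarrow> 'p \<Rightarrow> complex)" where
  "inv_on S M = (THE N. inverse_on S M N)"

definition Gcov :: "nat \<Rightarrow> real \<Rightarrow> ('x::finite) cmat \<Rightarrow> (nat \<Rightarrow> 'x \<Rightarrow> complex)
                     \<Rightarrow> (nat \<times> 'x) \<Rightarrow> (nat \<times> 'x) \<Rightarrow> complex" where
  "Gcov n\<tau> eps Emuv h = inv_on (XT n\<tau>) (Kmat n\<tau> eps Emuv h)"

definition opnorm_on :: "'p set \<Rightarrow> ('p \<Rightarrow> 'p \<Rightarrow> complex) \<Rightarrow> real" where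
  "opnorm_on S M = Sup {sqrt (\<Sum>p\<in>S. (cmod (\<Sum>q\<in>S. M p q * f q))\<^sup>2) | f.
                         (\<Sum>q\<in>S. (cmod (f q))\<^sup>2) \<le> 1}"

text \<open>Analyticity in the finitely many complex variables h_{j,x}, (j,x) in I, on D
  (Osgood: continuous and holomorphic in each variable separately).\<close>
definition analytic_several :: "(nat \<times> 'x) set \<Rightarrow> (nat \<Rightarrow> 'x \<Rightarrow> complex) set
                                 \<Rightarrow> ((nat \<Rightarrow> 'x \<Rightarrow> complex) \<Rightarrow> complex) \<Rightarrow> bool" where
  "analytic_several I D F \<longleftrightarrow> continuous_on D F \<and>
     (\<forall>h\<in>D. \<forall>(j, x)\<in>I. (\<lambda>z. F (h(j := (h j)(x := z))))
                          holomorphic_on {z. h(j := (h j)(x := z)) \<in> D})"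

text \<open>The measure Da = prod_{j,x} d abar d a / (2 pi i) = prod (d Re a d Im a / pi).\<close>
definition Da :: "nat \<Rightarrow> (nat \<times> ('x::finite) \<Rightarrow> complex) measure" where
  "Da n\<tau> = PiM (XT n\<tau>) (\<lambda>_. density lborel (\<lambda>_. ennreal (1 / pi)))"

end

theory Submission
  imports Defs
begin

text \<open>
  Write \<open>A = \<E>\<^sub>\<mu>\<close> and \<open>K(h) = 1 - N(h)\<close>. The Rayleigh quotient of \<open>A\<close> is at least \<open>e_min A\<close>, so the
  flow \<open>u' = -A u\<close> gives \<open>\<parallel>exp (-\<epsilon> A)\<parallel> \<le> exp (-\<epsilon> e_min A)\<close>, and each of the \<open>n\<close> forward blocks
  of \<open>N(h)\<close> has norm at most some \<open>r < 1\<close> as long as \<open>|Im h| \<le> c < \<surd>\<epsilon> e_min A\<close>; only the block closing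
  the time circle has norm 1. Weighting time slice \<open>j\<close> by \<open>r\<^bsup>j/2\<^esup>\<close> makes \<open>N(h)\<close> a strict contraction,
  so the Neumann series \<open>G(h) = \<Sum>\<^sub>k N(h)\<^sup>k\<close> converges with bounds depending only on \<open>c\<close>. The resolvent
  identity turns these bounds into continuity and complex differentiability of \<open>G\<close>. If \<open>A\<close> generates a
  stochastic process, the entries of \<open>N(0)\<close> are nonnegative and dominate those of \<open>N(h)\<close>, hence the same
  holds for the Neumann series. Finally, AM-GM around the circle gives
  \<open>Re (a, K(h) a) \<ge> (1 - r)/2 |a|\<^sup>2\<close> for real \<open>h\<close>, a Gaussian bound on the integrand.
\<close>

section \<open>The smallest eigenvalue\<close>

text \<open>Vectors are taken in \<open>complex^'x\<close>, a Euclidean space whose real inner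
  product is the real part of the hermitian one. Compactness, orthogonality and norm estimates then
  apply directly.\<close>

definition mat_vec :: "('x::finite) cmat \<Rightarrow> complex^'x \<Rightarrow> complex^'x" where
  "mat_vec A f = (\<chi> x. \<Sum>y\<in>UNIV. A x y * f $ y)"

lemma mat_vec_nth [simp]: "mat_vec A f $ x = (\<Sum>y\<in>UNIV. A x y * f $ y)"
  by (simp add: mat_vec_def)

lemma linear_mat_vec: "linear (mat_vec A)"
  by (rule linearI)
     (simp_all add: vec_eq_iff distrib_left sum.distrib scaleR_sum_right)

lemma inner_complex_vec: "(f::complex^'x::finite) \<bullet> g = Re (\<Sum>x\<in>UNIV. cnj (f $ x) * g $ x)"
  by (simp add: inner_vec_def inner_complex_def)

lemma inner_mat_vec:
  "f \<bullet> mat_vec A g = Re (\<Sum>x\<in>UNIV. \<Sum>y\<in>UNIV. cnj (f $ x) * A x y * g $ y)"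
  by (simp add: inner_complex_vec sum_distrib_left mult.assoc)

lemma hermitian_mat_vec_adjoint:
  assumes "hermitian A"
  shows "mat_vec A f \<bullet> g = f \<bullet> mat_vec A g"
proof -
  have cnj_A: "cnj (A x y) = A y x" for x y
    using assms unfolding hermitian_def by metis
  have "g \<bullet> mat_vec A f = Re (cnj (\<Sum>x\<in>UNIV. \<Sum>y\<in>UNIV. cnj (g $ x) * A x y * f $ y))"
    by (simp only: inner_mat_vec cnj.simps(1))
  also have "\<dots> = Re (\<Sum>x\<in>UNIV. \<Sum>y\<in>UNIV. g $ x * A y x * cnj (f $ y))"
    by (simp add: cnj_A)
  also have "\<dots> = Re (\<Sum>y\<in>UNIV. \<Sum>x\<in>UNIV. g $ x * A y x * cnj (f $ y))"
    by (subst sum.swap) simp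
  also have "\<dots> = f \<bullet> mat_vec A g"
    by (simp add: inner_mat_vec mult_ac)
  finally show ?thesis by (simp add: inner_commute)
qed

lemma is_eigenvalue_real_iff:
  "is_eigenvalue A (complex_of_real r) \<longleftrightarrow> (\<exists>f. f \<noteq> 0 \<and> mat_vec A f = r *\<^sub>R f)"
proof
  assume "is_eigenvalue A (complex_of_real r)"
  then obtain f where f: "f \<noteq> (\<lambda>_. 0)" "\<forall>x. (\<Sum>y\<in>UNIV. A x y * f y) = complex_of_real r * f x"
    by (auto simp: is_eigenvalue_def)
  then have "vec_lambda f \<noteq> 0 \<and> mat_vec A (vec_lambda f) = r *\<^sub>R vec_lambda f"
    by (auto simp: vec_eq_iff fun_eq_iff scaleR_conv_of_real[where 'a = complex])
  then show "\<exists>f. f \<noteq> 0 \<and> mat_vec A f = r *\<^sub>R f" by blast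
next
  assume "\<exists>f. f \<noteq> 0 \<and> mat_vec A f = r *\<^sub>R f"
  then obtain f where "f \<noteq> 0" "mat_vec A f = r *\<^sub>R f" by blast
  then show "is_eigenvalue A (complex_of_real r)"
    unfolding is_eigenvalue_def
    by (intro exI[of _ "\<lambda>x. f $ x"]) (auto simp: vec_eq_iff fun_eq_iff scaleR_conv_of_real[where 'a = complex])
qed

text \<open>Eigenvectors for distinct real eigenvalues are orthogonal, hence independent, and the
  finite dimension bounds their number. Finiteness is what gives the \<open>Min\<close> in
  \<open>e_min\<close> its meaning.\<close>

lemma finite_real_eigenvalues:
  assumes "hermitian A"
  shows "finite {r. is_eigenvalue A (complex_of_real r)}" (is "finite ?R")
proof -
  have "\<forall>r\<in>?R. \<exists>f. f \<noteq> 0 \<and> mat_vec A f = r *\<^sub>R f"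
    by (simp add: is_eigenvalue_real_iff)
  from bchoice[OF this] obtain f
    where f: "\<And>r. r \<in> ?R \<Longrightarrow> f r \<noteq> 0 \<and> mat_vec A (f r) = r *\<^sub>R f r"
    by blast
  have orth: "f r \<bullet> f s = 0" if "r \<in> ?R" "s \<in> ?R" "r \<noteq> s" for r s
  proof -
    have "r * (f r \<bullet> f s) = s * (f r \<bullet> f s)"
      using hermitian_mat_vec_adjoint[OF assms, of "f r" "f s"] f[OF that(1)] f[OF that(2)] by simp
    with that(3) show ?thesis by simp
  qed
  have inj: "inj_on f ?R"
  proof (rule inj_onI, rule ccontr)
    fix r s assume "r \<in> ?R" "s \<in> ?R" "f r = f s" "r \<noteq> s"
    then show False using orth[of r s] f[of s] by simp
  qed
  have "pairwise orthogonal (f ` ?R)"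
    unfolding pairwise_def orthogonal_def using orth by blast
  moreover have "0 \<notin> f ` ?R" using f by auto
  ultimately have "finite (f ` ?R)"
    using pairwise_orthogonal_independent independent_bound by blast
  with inj show ?thesis by (simp add: finite_image_iff)
qed

text \<open>The quadratic form attains its minimum on the compact unit sphere, and the first
  variation at a minimiser \<open>f\<close> forces the residual \<open>w = A f - l f\<close> to
  vanish.\<close>

lemma hermitian_Rayleigh_minimum:
  assumes herm: "hermitian A"
  obtains l f where "f \<noteq> 0" "mat_vec A f = l *\<^sub>R f" "\<And>g. l * (g \<bullet> g) \<le> g \<bullet> mat_vec A g"
proof -
  let ?S = "sphere (0::complex^'a) 1"
  have lin: "linear (mat_vec A)" by (rule linear_mat_vec)
  have cont: "continuous_on ?S (\<lambda>g. g \<bullet> mat_vec A g)"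
    using lin by (intro continuous_on_inner continuous_on_id linear_continuous_on)
      (simp add: linear_conv_bounded_linear)
  \<comment> \<open>Any unit vector will do: this only shows that the sphere is nonempty.\<close>
  have "axis undefined 1 \<in> ?S" by simp
  then obtain f where f: "f \<in> ?S" "\<And>g. g \<in> ?S \<Longrightarrow> f \<bullet> mat_vec A f \<le> g \<bullet> mat_vec A g"
    using continuous_attains_inf[OF compact_sphere _ cont] by (metis empty_iff)
  define l where "l = f \<bullet> mat_vec A f"
  have ray: "l * (g \<bullet> g) \<le> g \<bullet> mat_vec A g" for g
  proof (cases "g = 0")
    case False
    let ?u = "g /\<^sub>R norm g"
    have "l \<le> ?u \<bullet> mat_vec A ?u"
      using f(2)[of ?u] False by (simp add: l_def)
    also have "\<dots> = (g \<bullet> mat_vec A g) / (g \<bullet> g)"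
      by (simp add: linear_scale[OF lin] dot_square_norm power2_eq_square divide_simps)
    finally show ?thesis using False by (simp add: field_simps)
  qed simp
  define w where "w = mat_vec A f - l *\<^sub>R f"
  define C where "C = w \<bullet> mat_vec A w - l * (w \<bullet> w)"
  have ff: "f \<bullet> f = 1" using f(1) by (simp add: dot_square_norm)
  \<comment> \<open>the form \<open>g \<bullet> A g - l |g|\<^sup>2\<close> is nonnegative and vanishes at \<open>f\<close>, so its variation in direction \<open>w\<close> vanishes\<close>
  have quad: "0 \<le> 2 * s * (w \<bullet> w) + s\<^sup>2 * C" for s
  proof -
    let ?g = "f + s *\<^sub>R w"
    have "f \<bullet> mat_vec A w = w \<bullet> mat_vec A f"
      using hermitian_mat_vec_adjoint[OF herm, of f w] by (simp add: inner_commute[of w])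
    then have q1: "?g \<bullet> mat_vec A ?g = l + 2 * s * (w \<bullet> mat_vec A f) + s\<^sup>2 * (w \<bullet> mat_vec A w)"
      by (simp add: linear_add[OF lin] linear_scale[OF lin] inner_add_left inner_add_right
          l_def power2_eq_square distrib_left)
    have q2: "?g \<bullet> ?g = 1 + 2 * s * (w \<bullet> f) + s\<^sup>2 * (w \<bullet> w)"
      by (simp add: inner_add_left inner_add_right ff inner_commute[of f w] power2_eq_square distrib_left)
    have "?g \<bullet> mat_vec A ?g - l * (?g \<bullet> ?g)
        = 2 * s * (w \<bullet> mat_vec A f) - 2 * s * l * (w \<bullet> f) + s\<^sup>2 * C"
      unfolding q1 q2 C_def by (simp only: right_diff_distrib distrib_left) (simp add: mult_ac)
    also have "\<dots> = 2 * s * (w \<bullet> w) + s\<^sup>2 * C"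
      by (simp add: w_def inner_diff_right algebra_simps)
    finally show ?thesis using ray[of ?g] by simp
  qed
  have "w \<bullet> w = 0"
  proof (rule ccontr)
    assume "w \<bullet> w \<noteq> 0"
    then have pos: "w \<bullet> w > 0" by (metis inner_eq_zero_iff inner_gt_zero_iff)
    \<comment> \<open>A negative step so small that the second-order term cannot compensate the
      first-order one: dividing \<open>quad\<close> by \<open>s\<close> gives
      \<open>2 * (w \<bullet> w) + s * C \<le> 0\<close>, although \<open>s * C\<close> is at most
      \<open>w \<bullet> w\<close> in absolute value.\<close>
    define s where "s = - (w \<bullet> w) / (\<bar>C\<bar> + 1)"
    have s: "s < 0" using pos by (simp add: s_def divide_neg_pos)
    have "2 * (w \<bullet> w) + s * C \<le> 0"
    proof -
      have "s * (2 * (w \<bullet> w) + s * C) \<ge> 0"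
        using quad[of s] by (simp add: algebra_simps power2_eq_square)
      with s show ?thesis by (simp add: zero_le_mult_iff)
    qed
    moreover have "\<bar>s * C\<bar> \<le> w \<bullet> w"
    proof -
      have "\<bar>s * C\<bar> = (w \<bullet> w) * (\<bar>C\<bar> / (\<bar>C\<bar> + 1))"
        using pos by (simp add: s_def abs_mult)
      also have "\<dots> \<le> (w \<bullet> w) * 1"
        using pos by (intro mult_left_mono) auto
      finally show ?thesis by simp
    qed
    ultimately show False using pos by linarith
  qed
  then have "mat_vec A f = l *\<^sub>R f" by (simp add: w_def)
  moreover have "f \<noteq> 0" using f(1) by auto
  ultimately show thesis using that ray by simp
qed

text \<open>The Rayleigh minimum is itself an eigenvalue, and testing the form on an eigenvector
  shows that no real eigenvalue lies below it.\<close>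

lemma e_min_Rayleigh:
  assumes "hermitian A"
  shows "e_min A * (g \<bullet> g) \<le> g \<bullet> mat_vec A g"
    and "is_eigenvalue A (complex_of_real (e_min A))"
proof -
  obtain l f where lf: "f \<noteq> 0" "mat_vec A f = l *\<^sub>R f" and ray: "\<And>g. l * (g \<bullet> g) \<le> g \<bullet> mat_vec A g"
    using hermitian_Rayleigh_minimum[OF assms] by blast
  have eig: "is_eigenvalue A (complex_of_real l)"
    using lf is_eigenvalue_real_iff by blast
  have "l \<le> r" if "is_eigenvalue A (complex_of_real r)" for r
  proof -
    obtain k where k: "k \<noteq> 0" "mat_vec A k = r *\<^sub>R k" using \<open>is_eigenvalue A (complex_of_real r)\<close> is_eigenvalue_real_iff by blast
    then show ?thesis using ray[of k] by simp
  qed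
  then have "e_min A = l"
    unfolding e_min_def using finite_real_eigenvalues[OF assms] eig by (intro Min_eqI) auto
  with ray eig show "e_min A * (g \<bullet> g) \<le> g \<bullet> mat_vec A g"
    "is_eigenvalue A (complex_of_real (e_min A))" by auto
qed

lemma e_min_pos:
  assumes "pos_def A"
  shows "e_min A > 0"
proof -
  have herm: "hermitian A" using assms by (simp add: pos_def_def)
  obtain f where f: "f \<noteq> 0" "mat_vec A f = e_min A *\<^sub>R f"
    using e_min_Rayleigh(2)[OF herm] is_eigenvalue_real_iff by blast
  then have "(\<lambda>x. f $ x) \<noteq> (\<lambda>_. 0)" by (auto simp: vec_eq_iff fun_eq_iff)
  then have "0 < f \<bullet> mat_vec A f"
    using assms unfolding pos_def_def inner_mat_vec by blast
  then have "0 < e_min A * (f \<bullet> f)" using f by simp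
  then show ?thesis using inner_ge_zero[of f] by (simp only: zero_less_mult_iff) linarith
qed

section \<open>The matrix exponential\<close>

lemma mpow_0 [simp]: "mpow A 0 = mid"
  by (simp add: mpow_def)

lemma mpow_Suc: "mpow A (Suc k) x y = (\<Sum>z\<in>UNIV. A x z * mpow A k z y)"
  by (simp add: mpow_def mmult_def)

lemma mpow_mscale: "mpow (mscale c A) k x y = c ^ k * mpow A k x y"
  by (induction k arbitrary: x)
     (simp_all add: mpow_Suc mscale_def sum_distrib_left mult_ac)

text \<open>The sum of all entry norms dominates each row sum, which is crude but enough for the
  exponential series to converge for every complex parameter.\<close>

lemma norm_mpow_le: "norm (mpow A k x y) \<le> (\<Sum>x\<in>UNIV. \<Sum>y\<in>UNIV. norm (A x y)) ^ k" (is "_ \<le> ?M ^ k")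
proof (induction k arbitrary: x)
  case 0
  then show ?case by (simp add: mid_def)
next
  case (Suc k)
  have M: "0 \<le> ?M" by (intro sum_nonneg) auto
  have "norm (mpow A (Suc k) x y) \<le> (\<Sum>z\<in>UNIV. norm (A x z) * ?M ^ k)"
    unfolding mpow_Suc using Suc
    by (intro order_trans[OF norm_sum] sum_mono) (simp add: norm_mult mult_left_mono)
  also have "\<dots> = (\<Sum>z\<in>UNIV. norm (A x z)) * ?M ^ k"
    by (simp add: sum_distrib_right)
  also have "\<dots> \<le> ?M * ?M ^ k"
    by (intro mult_right_mono zero_le_power[OF M]
        member_le_sum[where f = "\<lambda>x. \<Sum>y\<in>UNIV. norm (A x y)"]) (auto intro: sum_nonneg)
  finally show ?case by simp
qed

lemma summable_mexp_series: "summable (\<lambda>k. mpow A k x y / of_nat (fact k) * (z::complex) ^ k)"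
proof (rule summable_comparison_test')
  let ?M = "\<Sum>x\<in>UNIV. \<Sum>y\<in>UNIV. norm (A x y)"
  show "summable (\<lambda>k. inverse (fact k) * (?M * norm z) ^ k)"
    by (rule summable_exp)
  show "norm (mpow A k x y / of_nat (fact k) * z ^ k) \<le> inverse (fact k) * (?M * norm z) ^ k" for k
    using norm_mpow_le[of A k x y]
    by (simp add: norm_mult norm_divide norm_power power_mult_distrib divide_simps mult_right_mono)
qed

lemma mexp_mscale: "mexp (mscale z A) x y = (\<Sum>k. mpow A k x y / of_nat (fact k) * z ^ k)"
  by (simp add: mexp_def mpow_mscale mult_ac)

lemma mexp_mscale_0: "mexp (mscale 0 A) x y = mid x y"
  unfolding mexp_mscale by (subst suminf_finite[of "{0}"]) auto

text \<open>Termwise differentiation of the everywhere convergent power series in \<open>z\<close>;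
  the index shift releases one factor \<open>A\<close> on the left.\<close>

lemma DERIV_mexp_mscale:
  "((\<lambda>z. mexp (mscale z A) x y) has_field_derivative
     (\<Sum>w\<in>UNIV. A x w * mexp (mscale z A) w y)) (at z)"
proof -
  let ?c = "\<lambda>x k. mpow A k x y / of_nat (fact k)"
  have "((\<lambda>z. \<Sum>k. ?c x k * z ^ k) has_field_derivative (\<Sum>k. diffs (?c x) k * z ^ k)) (at z)"
    by (rule termdiffs_strong_converges_everywhere) (rule summable_mexp_series)
  moreover have "diffs (?c x) k * z ^ k = (\<Sum>w\<in>UNIV. A x w * (?c w k * z ^ k))" for k
  proof -
    have "diffs (?c x) k = mpow A (Suc k) x y / of_nat (fact k)"
      by (simp add: diffs_def divide_simps del: of_nat_Suc) 
    also have "\<dots> = (\<Sum>w\<in>UNIV. A x w * ?c w k)"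
      by (simp add: mpow_Suc sum_divide_distrib)
    finally show ?thesis by (simp add: sum_distrib_right mult.assoc)
  qed
  moreover have "(\<Sum>k. \<Sum>w\<in>UNIV. A x w * (?c w k * z ^ k)) = (\<Sum>w\<in>UNIV. A x w * (\<Sum>k. ?c w k * z ^ k))"
    by (simp only: suminf_sum[OF summable_mult[OF summable_mexp_series]]
        suminf_mult[OF summable_mexp_series])
  ultimately show ?thesis by (simp add: mexp_mscale)
qed

text \<open>An energy estimate takes the place of diagonalisation. Along \<open>U' = - A U\<close>
  the function \<open>exp (2 * e_min A * t) * (U t \<bullet> U t)\<close> has derivative \<open>2 *
  exp (2 * e_min A * t) * (e_min A * (U t \<bullet> U t) - U t \<bullet> mat_vec A (U t))\<close>,
  which the Rayleigh bound makes nonpositive.\<close>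

lemma norm_mexp_vec_le:
  assumes herm: "hermitian A" and "0 \<le> t"
  shows "norm (mat_vec (mexp (mscale (- complex_of_real t) A)) f) \<le> exp (- t * e_min A) * norm f"
proof -
  define U where "U t = mat_vec (mexp (mscale (- complex_of_real t) A)) f" for t
  have U0: "U 0 = f"
    by (simp add: U_def vec_eq_iff mexp_mscale_0 mid_def if_distrib[of "\<lambda>c. c * _"] cong: if_cong)
  have dU: "((\<lambda>t. U t $ x) has_vector_derivative (- mat_vec A (U t)) $ x) (at t)" for t x
  proof -
    have entry: "((\<lambda>t. mexp (mscale (- complex_of_real t) A) x y) has_vector_derivative
        - (\<Sum>w\<in>UNIV. A x w * mexp (mscale (- complex_of_real t) A) w y)) (at t)" for x y
    proof -
      have inner: "((\<lambda>t. - complex_of_real t) has_vector_derivative - 1) (at t)"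
        by (auto intro!: derivative_eq_intros)
      show ?thesis
        using field_vector_diff_chain_at[OF inner DERIV_mexp_mscale[of A x y]]
        by (simp add: o_def)
    qed
    have "((\<lambda>t. U t $ x) has_vector_derivative
        (\<Sum>y\<in>UNIV. - (\<Sum>w\<in>UNIV. A x w * mexp (mscale (- complex_of_real t) A) w y) * f $ y)) (at t)"
      unfolding U_def mat_vec_nth
      by (intro has_vector_derivative_sum has_vector_derivative_mult_left entry)
    also have "(\<Sum>y\<in>UNIV. - (\<Sum>w\<in>UNIV. A x w * mexp (mscale (- complex_of_real t) A) w y) * f $ y)
        = - (\<Sum>y\<in>UNIV. \<Sum>w\<in>UNIV. A x w * (mexp (mscale (- complex_of_real t) A) w y * f $ y))"
      by (simp add: sum_distrib_right sum_negf mult.assoc)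
    also have "\<dots> = (- mat_vec A (U t)) $ x"
      by (subst sum.swap) (simp add: U_def sum_distrib_left)
    finally show ?thesis .
  qed
  define \<phi> where "\<phi> t = exp (2 * e_min A * t) * (U t \<bullet> U t)" for t
  have "\<phi> t \<le> \<phi> 0"
  proof (rule DERIV_nonpos_imp_nonincreasing[OF \<open>0 \<le> t\<close>])
    fix s :: real
    have inn: "((\<lambda>t. U t \<bullet> U t) has_real_derivative - 2 * (U s \<bullet> mat_vec A (U s))) (at s)"
    proof -
      have "((\<lambda>t. \<Sum>x\<in>UNIV. U t $ x \<bullet> U t $ x) has_derivative
          (\<lambda>h. \<Sum>x\<in>UNIV. U s $ x \<bullet> (h *\<^sub>R (- mat_vec A (U s)) $ x)
                        + (h *\<^sub>R (- mat_vec A (U s)) $ x) \<bullet> U s $ x)) (at s)"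
        by (intro has_derivative_sum has_derivative_inner dU[unfolded has_vector_derivative_def])
      then have "((\<lambda>t. U t \<bullet> U t) has_derivative
          ((*) (- 2 * (U s \<bullet> mat_vec A (U s))))) (at s)"
        unfolding inner_vec_def[symmetric]
        by (rule has_derivative_eq_rhs)
           (simp add: fun_eq_iff inner_vec_def[of "U s"] inner_commute[of "mat_vec A (U s) $ _"]
             sum_distrib_left sum_distrib_right sum_negf mult_ac del: mat_vec_nth)
      then show ?thesis
        unfolding has_field_derivative_def
        by simp
    qed
    have "(\<phi> has_real_derivative exp (2 * e_min A * s) * (2 * e_min A) * (U s \<bullet> U s)
        + - 2 * (U s \<bullet> mat_vec A (U s)) * exp (2 * e_min A * s)) (at s)"
      unfolding \<phi>_def by (intro DERIV_mult inn) (auto intro!: derivative_eq_intros)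
    moreover have "exp (2 * e_min A * s) * (2 * e_min A) * (U s \<bullet> U s)
        + - 2 * (U s \<bullet> mat_vec A (U s)) * exp (2 * e_min A * s)
        = 2 * exp (2 * e_min A * s) * (e_min A * (U s \<bullet> U s) - U s \<bullet> mat_vec A (U s))"
      by (simp add: algebra_simps)
    moreover have "\<dots> \<le> 0"
      using e_min_Rayleigh(1)[OF herm, of "U s"] by (simp add: mult_nonneg_nonpos)
    ultimately show "\<exists>y. DERIV \<phi> s :> y \<and> y \<le> 0" by metis
  qed
  \<comment> \<open>The monotonicity of \<phi> is the square of the claimed inequality.\<close>
  then have "(exp (t * e_min A) * norm (U t))\<^sup>2 \<le> (norm f)\<^sup>2"
    by (simp add: \<phi>_def U0 dot_square_norm power_mult_distrib exp_double[of "e_min A * t"]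
        mult.assoc mult.commute[of t])
  then have "exp (t * e_min A) * norm (U t) \<le> norm f"
    by (rule power2_le_imp_le) simp
  then show ?thesis
    by (simp add: U_def exp_minus divide_simps mult.commute[of "norm _"])
qed

section \<open>Neumann series and the resolvent identity\<close>

text \<open>Powers relative to a finite index set \<open>S\<close>: space-time points live in the
  infinite type of pairs with a \<open>nat\<close> component, so \<open>mpow\<close> does not
  apply.\<close>

primrec npow :: "'p set \<Rightarrow> ('p \<Rightarrow> 'p \<Rightarrow> complex) \<Rightarrow> nat \<Rightarrow> 'p \<Rightarrow> 'p \<Rightarrow> complex" where
  "npow S N 0 = (\<lambda>p q. if p = q then 1 else 0)"
| "npow S N (Suc k) = (\<lambda>p q. \<Sum>r\<in>S. N p r * npow S N k r q)"

text \<open>Peeling a factor off on the right serves the second half of the two-sided inverse,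
  \<open>G N = G - 1\<close>.\<close>

lemma npow_Suc_right:
  assumes "finite S" "p \<in> S" "q \<in> S"
  shows "npow S N (Suc k) p q = (\<Sum>r\<in>S. npow S N k p r * N r q)"
  using assms(2)
proof (induction k arbitrary: p)
  case 0
  then show ?case using assms by (simp add: if_distrib[of "\<lambda>c. c * _"] if_distrib[of "\<lambda>c. _ * c"] cong: if_cong)
next
  case (Suc k)
  have "npow S N (Suc (Suc k)) p q = (\<Sum>t\<in>S. N p t * npow S N (Suc k) t q)" by simp
  also have "\<dots> = (\<Sum>t\<in>S. \<Sum>r\<in>S. N p t * (npow S N k t r * N r q))"
    using Suc.IH by (intro sum.cong refl) (simp only: sum_distrib_left)
  also have "\<dots> = (\<Sum>r\<in>S. \<Sum>t\<in>S. N p t * (npow S N k t r * N r q))"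
    by (rule sum.swap)
  also have "\<dots> = (\<Sum>r\<in>S. npow S N (Suc k) p r * N r q)"
    by (simp add: sum_distrib_right mult.assoc)
  finally show ?case .
qed

lemma summable_npow:
  assumes "\<And>k. norm (npow S N k p q) \<le> C * \<rho> ^ k" "0 \<le> \<rho>" "\<rho> < 1"
  shows "summable (\<lambda>k. npow S N k p q)"
proof (rule summable_comparison_test')
  show "summable (\<lambda>k. C * \<rho> ^ k)" using assms by (intro summable_mult summable_geometric) auto
qed (rule assms(1))

lemma norm_suminf_npow_le:
  assumes "\<And>k. norm (npow S N k p q) \<le> C * \<rho> ^ k" "0 \<le> \<rho>" "\<rho> < 1"
  shows "norm (\<Sum>k. npow S N k p q) \<le> C / (1 - \<rho>)"
proof -
  have "norm (\<Sum>k. npow S N k p q) \<le> (\<Sum>k. C * \<rho> ^ k)"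
    using assms by (intro norm_suminf_le summable_mult summable_geometric) auto
  also have "\<dots> = C / (1 - \<rho>)"
    using assms by (subst suminf_mult) (auto simp: summable_geometric suminf_geometric)
  finally show ?thesis .
qed

text \<open>Splitting off the term \<open>k = 0\<close> gives \<open>G = 1 + N G = 1 + G N\<close>.
  The constant \<open>C\<close> leaves room for powers that decay only in an equivalent norm, as
  happens for the weighted slices below.\<close>

lemma inverse_on_neumann:
  assumes "finite S"
    and K: "\<And>p q. K p q = (if p = q then 1 else 0) - N p q"
    and bound: "\<And>k p q. p \<in> S \<Longrightarrow> q \<in> S \<Longrightarrow> norm (npow S N k p q) \<le> C * \<rho> ^ k"
    and "0 \<le> \<rho>" "\<rho> < 1"
  shows "inverse_on S K (\<lambda>p q. if p \<in> S \<and> q \<in> S then \<Sum>k. npow S N k p q else 0)"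
proof -
  let ?G = "\<lambda>p q. \<Sum>k. npow S N k p q"
  have sm: "summable (\<lambda>k. npow S N k p q)" if "p \<in> S" "q \<in> S" for p q
    using assms that by (intro summable_npow) auto
  have head: "?G p q = (if p = q then 1 else 0) + (\<Sum>k. npow S N (Suc k) p q)"
    if "p \<in> S" "q \<in> S" for p q
    using suminf_split_head[OF sm[OF that]] by simp
  have left: "(\<Sum>r\<in>S. N p r * ?G r q) = (\<Sum>k. npow S N (Suc k) p q)"
    if "p \<in> S" "q \<in> S" for p q
  proof -
    have "(\<Sum>k. \<Sum>r\<in>S. N p r * npow S N k r q) = (\<Sum>r\<in>S. \<Sum>k. N p r * npow S N k r q)"
      using that by (intro suminf_sum summable_mult sm)
    also have "\<dots> = (\<Sum>r\<in>S. N p r * ?G r q)"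
      using that by (intro sum.cong refl suminf_mult sm)
    finally show ?thesis by simp
  qed
  have right: "(\<Sum>r\<in>S. ?G p r * N r q) = (\<Sum>k. npow S N (Suc k) p q)"
    if "p \<in> S" "q \<in> S" for p q
  proof -
    have "(\<Sum>k. \<Sum>r\<in>S. npow S N k p r * N r q) = (\<Sum>r\<in>S. \<Sum>k. npow S N k p r * N r q)"
      using that by (intro suminf_sum summable_mult2 sm)
    also have "\<dots> = (\<Sum>r\<in>S. ?G p r * N r q)"
      using that by (intro sum.cong refl suminf_mult2[symmetric] sm)
    finally show ?thesis
      using that \<open>finite S\<close> by (simp only: npow_Suc_right)
  qed
  have l: "(\<Sum>r\<in>S. K p r * ?G r q) = (if p = q then 1 else 0)" if "p \<in> S" "q \<in> S" for p q
  proof -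
    have "(\<Sum>r\<in>S. K p r * ?G r q) = (\<Sum>r\<in>S. if p = r then ?G r q else 0) - (\<Sum>r\<in>S. N p r * ?G r q)"
      unfolding sum_subtractf[symmetric] by (intro sum.cong) (auto simp: K left_diff_distrib)
    with that \<open>finite S\<close> show ?thesis by (simp add: left[OF that] head[OF that] del: npow.simps)
  qed
  have r: "(\<Sum>r\<in>S. ?G p r * K r q) = (if p = q then 1 else 0)" if "p \<in> S" "q \<in> S" for p q
  proof -
    have "(\<Sum>r\<in>S. ?G p r * K r q) = (\<Sum>r\<in>S. if r = q then ?G p r else 0) - (\<Sum>r\<in>S. ?G p r * N r q)"
      unfolding sum_subtractf[symmetric] by (intro sum.cong) (auto simp: K right_diff_distrib)
    with that \<open>finite S\<close> show ?thesis by (simp add: right[OF that] head[OF that] del: npow.simps)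
  qed
  show ?thesis
    unfolding inverse_on_def using l r by auto
qed

text \<open>\<open>G - G' = G (M' - M) G'\<close>: between \<open>G\<close> and \<open>G'\<close>,
  the matrix \<open>M'\<close> cancels \<open>G'\<close> and the matrix \<open>M\<close> cancels
  \<open>G\<close>.\<close>

lemma inverse_on_resolvent:
  assumes "finite S" "inverse_on S M G" "inverse_on S M' G'" "p \<in> S" "q \<in> S"
  shows "G p q - G' p q = (\<Sum>r\<in>S. \<Sum>s\<in>S. G p r * (M' r s - M r s) * G' s q)"
proof -
  have "(\<Sum>r\<in>S. \<Sum>s\<in>S. G p r * M' r s * G' s q) = (\<Sum>r\<in>S. G p r * (\<Sum>s\<in>S. M' r s * G' s q))"
    by (simp add: sum_distrib_left mult.assoc)
  also have "\<dots> = (\<Sum>r\<in>S. if r = q then G p r else 0)"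
    using assms by (intro sum.cong) (auto simp: inverse_on_def)
  also have "\<dots> = G p q" using assms by simp
  finally have 1: "(\<Sum>r\<in>S. \<Sum>s\<in>S. G p r * M' r s * G' s q) = G p q" .
  have "(\<Sum>r\<in>S. \<Sum>s\<in>S. G p r * M r s * G' s q) = (\<Sum>s\<in>S. \<Sum>r\<in>S. G p r * M r s * G' s q)"
    by (rule sum.swap)
  also have "\<dots> = (\<Sum>s\<in>S. (\<Sum>r\<in>S. G p r * M r s) * G' s q)"
    by (simp add: sum_distrib_right)
  also have "\<dots> = (\<Sum>s\<in>S. if p = s then G' s q else 0)"
    using assms by (intro sum.cong) (auto simp: inverse_on_def)
  also have "\<dots> = G' p q" using assms by simp
  finally have 2: "(\<Sum>r\<in>S. \<Sum>s\<in>S. G p r * M r s * G' s q) = G' p q" .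
  show ?thesis
    unfolding 1[symmetric] 2[symmetric] sum_subtractf[symmetric]
    by (simp add: right_diff_distrib left_diff_distrib)
qed

text \<open>The resolvent identity with equal matrices gives uniqueness on \<open>S\<close>. Off
  \<open>S\<close> both inverses are 0 by definition, so the description in \<open>inv_on\<close> is
  well defined.\<close>

lemma inv_on_eqI:
  assumes "finite S" "inverse_on S M G"
  shows "inv_on S M = G"
  unfolding inv_on_def
proof (rule the_equality)
  show "inverse_on S M G" by fact
next
  fix G' assume G': "inverse_on S M G'"
  show "G' = G"
  proof (intro ext)
    fix p q
    show "G' p q = G p q"
    proof (cases "p \<in> S \<and> q \<in> S")
      case True
      with inverse_on_resolvent[OF assms(1) G' assms(2), of p q] show ?thesis by simp
    next
      case False
      with G' assms(2) show ?thesis unfolding inverse_on_def by metis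
    qed
  qed
qed

section \<open>Regularity of the inverse of a matrix that depends on a parameter\<close>

text \<open>In \<open>G h - G h0 = G h (M h0 - M h) G h0\<close> the middle factor tends to 0, so
  local boundedness of \<open>G\<close> suffices.\<close>

lemma continuous_on_inverse_on:
  fixes M :: "'a::topological_space \<Rightarrow> 'p \<Rightarrow> 'p \<Rightarrow> complex"
  assumes S: "finite S" "p \<in> S" "q \<in> S"
    and inv: "\<And>h. h \<in> D \<Longrightarrow> inverse_on S (M h) (G h)"
    and cont: "\<And>r s. r \<in> S \<Longrightarrow> s \<in> S \<Longrightarrow> continuous_on D (\<lambda>h. M h r s)"
    and bound: "\<And>h0. h0 \<in> D \<Longrightarrow>
      \<exists>C. \<forall>\<^sub>F h in at h0 within D. \<forall>r\<in>S. \<forall>s\<in>S. norm (G h r s) \<le> C"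
  shows "continuous_on D (\<lambda>h. G h p q)"
  unfolding continuous_on_def
proof (intro ballI)
  fix h0 assume h0: "h0 \<in> D"
  obtain C where C: "\<forall>\<^sub>F h in at h0 within D. \<forall>r\<in>S. \<forall>s\<in>S. norm (G h r s) \<le> C"
    using bound[OF h0] by blast
  let ?b = "\<lambda>h. \<Sum>r\<in>S. \<Sum>s\<in>S. C * norm (M h0 r s - M h r s) * norm (G h0 s q)"
  have "((\<lambda>h. M h0 r s - M h r s) \<longlongrightarrow> M h0 r s - M h0 r s) (at h0 within D)" if "r \<in> S" "s \<in> S" for r s
    using cont[OF that] h0 by (intro tendsto_diff tendsto_const) (auto simp: continuous_on_def)
  then have "(?b \<longlongrightarrow> (\<Sum>r\<in>S. \<Sum>s\<in>S. C * norm (M h0 r s - M h0 r s) * norm (G h0 s q))) (at h0 within D)"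
    by (intro tendsto_sum tendsto_mult tendsto_const tendsto_norm) auto
  then have b: "(?b \<longlongrightarrow> 0) (at h0 within D)" by simp
  have "\<forall>\<^sub>F h in at h0 within D. h \<in> D" by (simp add: eventually_at_filter)
  with C have "\<forall>\<^sub>F h in at h0 within D. norm (G h p q - G h0 p q) \<le> ?b h"
  proof eventually_elim
    case (elim h)
    show ?case
      unfolding inverse_on_resolvent[OF S(1) inv[OF elim(2)] inv[OF h0] S(2,3)]
      using elim(1) S
      by (intro order_trans[OF norm_sum] sum_mono) (auto simp: norm_mult intro!: mult_right_mono)
  qed
  then have "((\<lambda>h. G h p q - G h0 p q) \<longlongrightarrow> 0) (at h0 within D)"
    by (rule Lim_null_comparison[OF _ b])
  then show "((\<lambda>h. G h p q) \<longlongrightarrow> G h0 p q) (at h0 within D)"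
    by (simp add: LIM_zero_iff)
qed

text \<open>Dividing the resolvent identity by \<open>z - w\<close> and letting \<open>z\<close>
  tend to \<open>w\<close> yields the derivative \<open>- G M' G\<close>; continuity of
  \<open>G\<close> takes care of the factor still evaluated at \<open>z\<close>.\<close>

lemma holomorphic_on_inverse_on:
  fixes M :: "complex \<Rightarrow> 'p \<Rightarrow> 'p \<Rightarrow> complex"
  assumes S: "finite S" "p \<in> S" "q \<in> S"
    and inv: "\<And>z. z \<in> Z \<Longrightarrow> inverse_on S (M z) (G z)"
    and hol: "\<And>r s. r \<in> S \<Longrightarrow> s \<in> S \<Longrightarrow> (\<lambda>z. M z r s) holomorphic_on Z"
    and cont: "\<And>r s. r \<in> S \<Longrightarrow> s \<in> S \<Longrightarrow> continuous_on Z (\<lambda>z. G z r s)"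
  shows "(\<lambda>z. G z p q) holomorphic_on Z"
  unfolding holomorphic_on_def
proof (intro ballI)
  fix w assume w: "w \<in> Z"
  have "\<exists>D. \<forall>r\<in>S. \<forall>s\<in>S. ((\<lambda>z. M z r s) has_field_derivative D r s) (at w within Z)"
    using hol w unfolding holomorphic_on_def field_differentiable_def
    by (intro bchoice[of S "\<lambda>r D. \<forall>s\<in>S. ((\<lambda>z. M z r s) has_field_derivative D s) (at w within Z)"]
        ballI bchoice) blast
  then obtain M' where M': "\<And>r s. r \<in> S \<Longrightarrow> s \<in> S \<Longrightarrow>
      ((\<lambda>z. M z r s) has_field_derivative M' r s) (at w within Z)" by blast
  let ?G' = "\<Sum>r\<in>S. \<Sum>s\<in>S. G w p r * - M' r s * G w s q"
  have quot: "((\<lambda>z. (M w r s - M z r s) / (z - w)) \<longlongrightarrow> - M' r s) (at w within Z)"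
    if "r \<in> S" "s \<in> S" for r s
    using tendsto_minus[OF M'[OF that, unfolded has_field_derivative_iff]]
    by (simp add: minus_divide_left)
  have G: "((\<lambda>z. G z p r) \<longlongrightarrow> G w p r) (at w within Z)" if "r \<in> S" for r
    using cont[OF S(2) that] w by (auto simp: continuous_on_def)
  have "((\<lambda>z. \<Sum>r\<in>S. \<Sum>s\<in>S. G z p r * ((M w r s - M z r s) / (z - w)) * G w s q) \<longlongrightarrow> ?G') (at w within Z)"
    by (intro tendsto_sum tendsto_mult tendsto_const G quot)
  moreover have "\<forall>\<^sub>F z in at w within Z.
      (\<Sum>r\<in>S. \<Sum>s\<in>S. G z p r * ((M w r s - M z r s) / (z - w)) * G w s q) = (G z p q - G w p q) / (z - w)"
  proof -
    have "\<forall>\<^sub>F z in at w within Z. z \<in> Z" by (simp add: eventually_at_filter)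
    then show ?thesis
      by eventually_elim
         (simp add: inverse_on_resolvent[OF S(1) inv inv[OF w] S(2,3)] sum_divide_distrib)
  qed
  ultimately have "((\<lambda>z. (G z p q - G w p q) / (z - w)) \<longlongrightarrow> ?G') (at w within Z)"
    by (rule Lim_transform_eventually)
  then show "(\<lambda>z. G z p q) field_differentiable at w within Z"
    unfolding field_differentiable_def has_field_derivative_iff by blast
qed

section \<open>The block matrix\<close>

text \<open>The matrix \<open>N(h)\<close> of the Neumann series. Its blocks lead from slice
  \<open>j\<close> to \<open>j + 1\<close> and from slice \<open>n\<close> back to slice 0.\<close>

definition hop :: "nat \<Rightarrow> real \<Rightarrow> ('x::finite) cmat \<Rightarrow> (nat \<Rightarrow> 'x \<Rightarrow> complex)
    \<Rightarrow> nat \<times> 'x \<Rightarrow> nat \<times> 'x \<Rightarrow> complex" where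
  "hop n eps A h p q = (if p = q then 1 else 0) - Kmat n eps A h p q"

text \<open>One forward block as an operator on a single time slice: the phase of the field acts
  first, then the heat kernel.\<close>

definition transfer :: "real \<Rightarrow> ('x::finite) cmat \<Rightarrow> ('x \<Rightarrow> complex) \<Rightarrow> complex^'x \<Rightarrow> complex^'x" where
  "transfer eps A \<eta> = mat_vec (\<lambda>x y. mexp (mscale (- complex_of_real eps) A) x y
      * exp (\<i> * complex_of_real (sqrt eps) * \<eta> y))"

definition slice :: "(nat \<times> 'x \<Rightarrow> complex) \<Rightarrow> nat \<Rightarrow> complex^('x::finite)" where
  "slice a j = (\<chi> x. a (j, x))"

lemma slice_nth [simp]: "slice a j $ x = a (j, x)"
  by (simp add: slice_def)

lemma finite_XT [simp]: "finite (XT n :: (nat \<times> 'x::finite) set)"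
  by (simp add: XT_def)

lemma mem_XT [simp]: "(j, x) \<in> XT n \<longleftrightarrow> j \<le> n"
  by (simp add: XT_def)

lemma sum_XT: "(\<Sum>p\<in>XT n. g p) = (\<Sum>j\<le>n. \<Sum>x\<in>UNIV. g (j, x))"
  by (simp add: XT_def sum.cartesian_product atLeast0AtMost split_def)

lemma hop_apply:
  "hop n eps A h (j, x) (j', x') =
     (if j' = Suc j then mexp (mscale (- complex_of_real eps) A) x x'
        * exp (\<i> * complex_of_real (sqrt eps) * h j' x') else 0)
   + (if j = n \<and> j' = 0 \<and> x = x' then 1 else 0)"
  by (auto simp: hop_def Kmat_def)

lemma sum_hop_less:
  assumes "j < n"
  shows "(\<Sum>q\<in>XT n. hop n eps A h (j, x) q * f q) = transfer eps A (h (Suc j)) (slice f (Suc j)) $ x"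
proof -
  have "(\<Sum>q\<in>XT n. hop n eps A h (j, x) q * f q)
      = (\<Sum>j'\<le>n. if j' = Suc j then transfer eps A (h (Suc j)) (slice f (Suc j)) $ x else 0)"
    unfolding sum_XT using assms
    by (intro sum.cong refl) (auto simp: hop_apply transfer_def)
  also have "\<dots> = transfer eps A (h (Suc j)) (slice f (Suc j)) $ x"
    using assms by simp
  finally show ?thesis .
qed

lemma sum_hop_last:
  "(\<Sum>q\<in>XT n. hop n eps A h (n, x) q * f q) = slice f 0 $ x"
proof -
  have "(\<Sum>q\<in>XT n. hop n eps A h (n, x) q * f q) = (\<Sum>j'\<le>n. if j' = 0 then slice f 0 $ x else 0)"
    unfolding sum_XT
    by (intro sum.cong refl) (auto simp: hop_apply if_distrib[of "\<lambda>c. c * _"] cong: if_cong)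
  also have "\<dots> = slice f 0 $ x" by simp
  finally show ?thesis .
qed

text \<open>Multiplication by the phase costs at most \<open>exp (sqrt eps * c)\<close>, and the
  semigroup bound supplies the decay.\<close>

lemma norm_transfer_le:
  assumes "hermitian A" "0 \<le> eps" "\<And>x. \<bar>Im (\<eta> x)\<bar> \<le> c"
  shows "norm (transfer eps A \<eta> f) \<le> exp (sqrt eps * c - eps * e_min A) * norm f"
proof -
  let ?u = "\<lambda>x. exp (\<i> * complex_of_real (sqrt eps) * \<eta> x)"
  have u: "norm (?u x) \<le> exp (sqrt eps * c)" for x
    using assms(2) assms(3)[of x] mult_left_mono[of "- Im (\<eta> x)" c "sqrt eps"] by simp
  have "transfer eps A \<eta> f = mat_vec (mexp (mscale (- complex_of_real eps) A)) (\<chi> y. ?u y * f $ y)"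
    by (simp add: transfer_def vec_eq_iff mult.assoc)
  then have "norm (transfer eps A \<eta> f) \<le> exp (- eps * e_min A) * norm (\<chi> y. ?u y * f $ y)"
    using norm_mexp_vec_le[OF assms(1,2)] by simp
  also have "norm (\<chi> y. ?u y * f $ y) \<le> norm (exp (sqrt eps * c) *\<^sub>R f)"
    using u by (intro norm_le_componentwise_cart)
      (simp add: norm_mult mult_right_mono del: norm_exp_eq_Re)
  finally show ?thesis by (simp add: exp_diff exp_minus field_simps)
qed

text \<open>Column \<open>q\<close> of the power is followed as a vector, slice by slice. The factor
  \<open>1 / s ^ n\<close> is the price of removing the weight at the end.\<close>

lemma norm_npow_hop_le:
  fixes A :: "('x::finite) cmat" and q :: "nat \<times> 'x"
  assumes s: "0 < s" "s < 1" and n: "1 \<le> n"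
    and contr: "\<And>j f. 1 \<le> j \<Longrightarrow> j \<le> n \<Longrightarrow> norm (transfer eps A (h j) f) \<le> s\<^sup>2 * norm f"
    and p: "p \<in> XT n"
  shows "norm (npow (XT n) (hop n eps A h) k p q) \<le> 1 / s ^ n * s ^ k"
proof -
  let ?f = "\<lambda>k p. npow (XT n) (hop n eps A h) k p q"
  \<comment> \<open>The weight \<open>s ^ j\<close> shares the contraction of the \<open>n\<close> propagation steps with the
      norm-preserving step that closes the time circle.\<close>
  have step: "s ^ j * norm (slice (?f k) j) \<le> s ^ k" if "j \<le> n" for j
    using that
  proof (induction k arbitrary: j)
    case 0
    \<comment> \<open>A slice of a column of the identity is either 0 or the unit vector at the
      spatial component of \<open>q\<close>.\<close>
    have "norm (slice (?f 0) j) \<le> norm (axis (snd q) 1 :: complex^'x)"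
      by (intro norm_le_componentwise_cart) (auto simp: axis_def)
    then show ?case using s by (simp add: mult_le_one power_le_one)
  next
    case (Suc k)
    show ?case
    proof (cases "j < n")
      case True
      have "slice (?f (Suc k)) j = transfer eps A (h (Suc j)) (slice (?f k) (Suc j))"
        using sum_hop_less[OF True, of eps A h _ "?f k"] by (simp add: vec_eq_iff)
      then have "s ^ j * norm (slice (?f (Suc k)) j) \<le> s ^ j * (s\<^sup>2 * norm (slice (?f k) (Suc j)))"
        using s True by (simp only:) (intro mult_left_mono contr, auto)
      \<comment> \<open>Of the two factors \<open>s\<close> in the contraction, one raises the
        weight to that of slice \<open>j + 1\<close> and the other is the gain per step.\<close>
      also have "\<dots> = s * (s ^ Suc j * norm (slice (?f k) (Suc j)))"
        by (simp add: power2_eq_square)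
      also have "\<dots> \<le> s * s ^ k"
        using s True by (intro mult_left_mono Suc.IH) auto
      finally show ?thesis by simp
    next
      case False
      with Suc.prems have j: "j = n" by simp
      have "slice (?f (Suc k)) n = slice (?f k) 0"
        using sum_hop_last[of n eps A h _ "?f k"] by (simp add: vec_eq_iff)
      \<comment> \<open>The closing step does not contract; its gain comes from the weight dropping
        from slice \<open>n\<close> to slice 0, and \<open>n \<ge> 1\<close> makes that at least one
        factor \<open>s\<close>.\<close>
      moreover have "s ^ n \<le> s ^ 1"
        using s n by (intro power_decreasing) auto
      moreover have "norm (slice (?f k) 0) \<le> s ^ k"
        using Suc.IH[of 0] by simp
      ultimately show ?thesis
        using s unfolding j by (simp only: power_Suc) (intro mult_mono, auto)
    qed
  qed
  obtain j x where jx: "p = (j, x)" "j \<le> n" using p by (cases p) auto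
  have "s ^ n * norm (?f k p) \<le> s ^ j * norm (slice (?f k) j)"
    using s jx Finite_Cartesian_Product.norm_nth_le[of "slice (?f k) j" x] by (intro mult_mono power_decreasing) auto
  also have "\<dots> \<le> s ^ k" using step jx by simp
  finally show ?thesis using s by (simp add: field_simps)
qed

text \<open>\<open>s\<close> is the square root of the bound on the forward blocks, and
  \<open>s < 1\<close> because \<open>c\<close> lies strictly below
  \<open>sqrt eps * e_min A\<close>. The final bound depends on the field only through
  \<open>c\<close>, which gives all uniform and local bounds later.\<close>

lemma Kmat_inverse_on:
  fixes A :: "('x::finite) cmat"
  assumes A: "hermitian A" and eps: "0 < eps" and n: "1 \<le> n"
    and h: "\<And>j x. 1 \<le> j \<Longrightarrow> j \<le> n \<Longrightarrow> \<bar>Im (h j x)\<bar> \<le> c"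
    and c: "c < sqrt eps * e_min A"
  defines "s \<equiv> exp ((sqrt eps * c - eps * e_min A) / 2)"
  shows "inverse_on (XT n) (Kmat n eps A h) (Gcov n eps A h)"
    and "p \<in> XT n \<Longrightarrow> q \<in> XT n \<Longrightarrow> summable (\<lambda>k. npow (XT n) (hop n eps A h) k p q)"
    and "p \<in> XT n \<Longrightarrow> q \<in> XT n \<Longrightarrow> Gcov n eps A h p q = (\<Sum>k. npow (XT n) (hop n eps A h) k p q)"
    and "p \<in> XT n \<Longrightarrow> q \<in> XT n \<Longrightarrow> norm (Gcov n eps A h p q) \<le> 1 / s ^ n / (1 - s)"
proof -
  have "sqrt eps * c < sqrt eps * (sqrt eps * e_min A)" using c eps by simp
  then have "sqrt eps * c < eps * e_min A" using eps by (simp add: mult.assoc[symmetric])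
  then have s: "0 < s" "s < 1" by (auto simp: s_def)
  have s2: "s\<^sup>2 = exp (sqrt eps * c - eps * e_min A)"
    by (simp add: s_def exp_double[symmetric])
  have contr: "norm (transfer eps A (h j) f) \<le> s\<^sup>2 * norm f" if "1 \<le> j" "j \<le> n" for j f
    unfolding s2 using A eps h that by (intro norm_transfer_le) auto
  have bound: "norm (npow (XT n) (hop n eps A h) k p q) \<le> 1 / s ^ n * s ^ k" if "p \<in> XT n" for k p q
    by (rule norm_npow_hop_le[OF s n contr that])
  have inv: "inverse_on (XT n) (Kmat n eps A h)
      (\<lambda>p q. if p \<in> XT n \<and> q \<in> XT n then \<Sum>k. npow (XT n) (hop n eps A h) k p q else 0)"
    using s by (intro inverse_on_neumann[where C = "1 / s ^ n" and \<rho> = s] bound) (auto simp: hop_def)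
  have G: "Gcov n eps A h =
      (\<lambda>p q. if p \<in> XT n \<and> q \<in> XT n then \<Sum>k. npow (XT n) (hop n eps A h) k p q else 0)"
    unfolding Gcov_def by (rule inv_on_eqI[OF finite_XT inv])
  show "inverse_on (XT n) (Kmat n eps A h) (Gcov n eps A h)" using inv G by simp
  assume pq: "p \<in> XT n" "q \<in> XT n"
  show "summable (\<lambda>k. npow (XT n) (hop n eps A h) k p q)"
    using s by (intro summable_npow[where C = "1 / s ^ n" and \<rho> = s] bound pq) auto
  show "Gcov n eps A h p q = (\<Sum>k. npow (XT n) (hop n eps A h) k p q)"
    using pq by (simp add: G)
  then show "norm (Gcov n eps A h p q) \<le> 1 / s ^ n / (1 - s)"
    using norm_suminf_npow_le[OF bound[OF pq(1)], of q] s by simp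
qed

section \<open>Operator norm bound and domination by the field-free covariance\<close>

text \<open>Every component of a vector in the unit ball has modulus at most 1, so bounded entries
  bound each row of the product.\<close>

lemma opnorm_on_le:
  assumes "finite S" "\<And>p q. p \<in> S \<Longrightarrow> q \<in> S \<Longrightarrow> norm (M p q) \<le> C"
  shows "opnorm_on S M \<le> sqrt (\<Sum>p\<in>S. (\<Sum>q\<in>S. C)\<^sup>2)"
  unfolding opnorm_on_def
proof (rule cSup_least)
  show "{sqrt (\<Sum>p\<in>S. (cmod (\<Sum>q\<in>S. M p q * f q))\<^sup>2) | f. (\<Sum>q\<in>S. (cmod (f q))\<^sup>2) \<le> 1} \<noteq> {}"
    by (auto intro!: exI[of _ "\<lambda>_. 0"])
next
  fix y assume "y \<in> {sqrt (\<Sum>p\<in>S. (cmod (\<Sum>q\<in>S. M p q * f q))\<^sup>2) | f. (\<Sum>q\<in>S. (cmod (f q))\<^sup>2) \<le> 1}"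
  then obtain f where y: "y = sqrt (\<Sum>p\<in>S. (cmod (\<Sum>q\<in>S. M p q * f q))\<^sup>2)"
    and f: "(\<Sum>q\<in>S. (cmod (f q))\<^sup>2) \<le> 1" by blast
  have f1: "cmod (f q) \<le> 1" if "q \<in> S" for q
  proof -
    have "(cmod (f q))\<^sup>2 \<le> (\<Sum>q\<in>S. (cmod (f q))\<^sup>2)"
      using that assms(1) by (intro member_le_sum) auto
    with f have "(cmod (f q))\<^sup>2 \<le> 1\<^sup>2" by simp
    then show ?thesis by (rule power2_le_imp_le) simp
  qed
  have "cmod (\<Sum>q\<in>S. M p q * f q) \<le> (\<Sum>q\<in>S. C)" if "p \<in> S" for p
  proof (intro order_trans[OF norm_sum] sum_mono)
    fix q assume "q \<in> S"
    then show "norm (M p q * f q) \<le> C"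
      using assms(2)[OF that, of q] f1[of q] mult_mono[of "cmod (M p q)" C "cmod (f q)" 1]
      by (simp add: norm_mult order_trans[OF norm_ge_zero])
  qed
  then show "y \<le> sqrt (\<Sum>p\<in>S. (\<Sum>q\<in>S. C)\<^sup>2)"
    unfolding y by (intro real_sqrt_le_mono sum_mono power_mono) auto
qed

text \<open>Entrywise domination survives sums and products. Realness of \<open>N'\<close> is
  carried along because \<open>Re\<close> is multiplicative on real entries.\<close>

lemma npow_dominated:
  assumes "\<And>p q. p \<in> S \<Longrightarrow> q \<in> S \<Longrightarrow> N' p q \<in> \<real> \<and> norm (N p q) \<le> Re (N' p q)"
    and "p \<in> S" "q \<in> S"
  shows "npow S N' k p q \<in> \<real> \<and> norm (npow S N k p q) \<le> Re (npow S N' k p q)"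
  using assms(2)
proof (induction k arbitrary: p)
  case 0
  then show ?case by simp
next
  case (Suc k)
  have "norm (npow S N (Suc k) p q) \<le> (\<Sum>r\<in>S. Re (N' p r * npow S N' k r q))"
    unfolding npow.simps
  proof (intro order_trans[OF norm_sum] sum_mono)
    fix r assume r: "r \<in> S"
    have "Re (N' p r * npow S N' k r q) = Re (N' p r) * Re (npow S N' k r q)"
      using assms(1)[OF Suc.prems r] by (simp add: complex_is_Real_iff)
    with assms(1)[OF Suc.prems r] Suc.IH[OF r]
    show "norm (N p r * npow S N k r q) \<le> Re (N' p r * npow S N' k r q)"
      using mult_mono'[of "norm (N p r)" "Re (N' p r)" "norm (npow S N k r q)" "Re (npow S N' k r q)"]
      by (simp only: norm_mult) simp
  qed
  then show ?case using assms(1)[OF Suc.prems] Suc.IH by (simp add: sum_in_Reals)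
qed

text \<open>For real \<open>h\<close> the phases have modulus 1 and the heat kernel entries are
  nonnegative, so \<open>hop\<close> at field 0 dominates \<open>hop\<close> at \<open>h\<close>;
  the two Neumann series are then compared term by term.\<close>

lemma Gcov_dominated:
  fixes A :: "('x::finite) cmat" and h :: "nat \<Rightarrow> 'x \<Rightarrow> real"
  assumes A: "hermitian A" and pos: "0 < e_min A" and eps: "0 < eps" and n: "1 \<le> n"
    and stoch: "generates_stochastic A" and pq: "p \<in> XT n" "q \<in> XT n"
  shows "Gcov n eps A (\<lambda>_ _. 0) p q \<in> \<real>"
    and "norm (Gcov n eps A (\<lambda>j x. complex_of_real (h j x)) p q) \<le> Re (Gcov n eps A (\<lambda>_ _. 0) p q)"
proof -
  let ?N = "\<lambda>h. npow (XT n) (hop n eps A h)"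
  let ?h = "\<lambda>j x. complex_of_real (h j x)"
  \<comment> \<open>Both fields are real, so the width \<open>c\<close> of the imaginary parts is
    taken to be 0.\<close>
  have c: "0 < sqrt eps * e_min A" using eps pos by simp
  note K0 = Kmat_inverse_on(2,3)[OF A eps n _ c pq, where h = "\<lambda>_ _. 0", simplified]
  note Kh = Kmat_inverse_on(2,3)[OF A eps n _ c pq, where h = ?h, simplified]
  have "hop n eps A (\<lambda>_ _. 0) p q \<in> \<real> \<and> norm (hop n eps A ?h p q) \<le> Re (hop n eps A (\<lambda>_ _. 0) p q)" for p q
  proof -
    let ?A = "mexp (mscale (- complex_of_real eps) A)"
    have "Im (?A x y) = 0 \<and> 0 \<le> Re (?A x y)" for x y
      using stoch eps unfolding generates_stochastic_def complex_is_Real_iff by simp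
    then have "?A x y \<in> \<real> \<and> norm (?A x y) = Re (?A x y) \<and> Im (?A x y) = 0" for x y
      by (simp add: complex_is_Real_iff cmod_eq_Re)
    then show ?thesis
      by (cases p; cases q) (simp add: hop_apply norm_mult)
  qed
  then have dom: "?N (\<lambda>_ _. 0) k p q \<in> \<real> \<and> norm (?N ?h k p q) \<le> Re (?N (\<lambda>_ _. 0) k p q)" for k
    using pq by (intro npow_dominated) auto
  show "Gcov n eps A (\<lambda>_ _. 0) p q \<in> \<real>"
    unfolding complex_is_Real_iff K0(2) Im_suminf[OF K0(1)]
    using dom by (simp add: complex_is_Real_iff)
  show "norm (Gcov n eps A ?h p q) \<le> Re (Gcov n eps A (\<lambda>_ _. 0) p q)"
    unfolding K0(2) Kh(2) Re_suminf[OF K0(1)]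
    using dom by (intro norm_suminf_le summable_Re K0(1)) auto
qed

section \<open>Absolute convergence\<close>

lemma Re_quadform_Kmat:
  "Re (quadform (XT n) (Kmat n eps A h) a) =
     (\<Sum>j\<le>n. (norm (slice a j))\<^sup>2)
     - (\<Sum>j<n. slice a j \<bullet> transfer eps A (h (Suc j)) (slice a (Suc j))) - slice a n \<bullet> slice a 0"
proof -
  let ?N = "\<lambda>p. \<Sum>q\<in>XT n. hop n eps A h p q * a q"
  have K: "(\<Sum>q\<in>XT n. Kmat n eps A h p q * a q) = a p - ?N p" if "p \<in> XT n" for p
  proof -
    have "(\<Sum>q\<in>XT n. Kmat n eps A h p q * a q) = (\<Sum>q\<in>XT n. if p = q then a q else 0) - ?N p"
      unfolding sum_subtractf[symmetric] by (intro sum.cong) (auto simp: hop_def algebra_simps)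
    then show ?thesis using that by simp
  qed
  have "quadform (XT n) (Kmat n eps A h) a = (\<Sum>p\<in>XT n. cnj (a p) * (a p - ?N p))"
    unfolding quadform_def by (intro sum.cong refl) (simp add: K[symmetric] sum_distrib_left mult.assoc)
  then have "Re (quadform (XT n) (Kmat n eps A h) a)
      = (\<Sum>j\<le>n. \<Sum>x\<in>UNIV. Re (cnj (a (j, x)) * a (j, x))) - (\<Sum>j\<le>n. \<Sum>x\<in>UNIV. Re (cnj (a (j, x)) * ?N (j, x)))"
    by (simp only: sum_XT right_diff_distrib sum_subtractf Re_sum minus_complex.sel)
  also have "(\<Sum>j\<le>n. \<Sum>x\<in>UNIV. Re (cnj (a (j, x)) * a (j, x))) = (\<Sum>j\<le>n. (norm (slice a j))\<^sup>2)"
    by (simp only: dot_square_norm[symmetric] inner_complex_vec slice_nth Re_sum)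
  also have "(\<Sum>j\<le>n. \<Sum>x\<in>UNIV. Re (cnj (a (j, x)) * ?N (j, x)))
      = (\<Sum>j<n. slice a j \<bullet> transfer eps A (h (Suc j)) (slice a (Suc j))) + slice a n \<bullet> slice a 0"
    unfolding lessThan_Suc_atMost[symmetric] sum.lessThan_Suc
    by (intro arg_cong2[of _ _ _ _ "(+)"] sum.cong refl)
       (simp_all only: sum_hop_last sum_hop_less inner_complex_vec Re_sum slice_nth lessThan_iff)
  finally show ?thesis by simp
qed

text \<open>AM-GM on neighbouring slices costs each interior slice \<open>r / 2\<close> twice,
  leaving \<open>1 - r\<close>. The slices 0 and \<open>n\<close> lose \<open>r / 2\<close> once and
  \<open>1 / 2\<close> through the closing link, which leaves the smallest coefficient
  \<open>(1 - r) / 2\<close>.\<close>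

lemma Re_quadform_Kmat_ge:
  assumes r: "0 \<le> r" "r \<le> 1" and n: "1 \<le> n"
    and contr: "\<And>j f. 1 \<le> j \<Longrightarrow> j \<le> n \<Longrightarrow> norm (transfer eps A (h j) f) \<le> r * norm f"
  shows "(1 - r) / 2 * (\<Sum>p\<in>XT n. (norm (a p))\<^sup>2) \<le> Re (quadform (XT n) (Kmat n eps A h) a)"
proof -
  let ?t = "\<lambda>j. norm (slice a j)"
  let ?T = "\<Sum>j\<le>n. (?t j)\<^sup>2"
  have amgm: "x * y \<le> (x\<^sup>2 + y\<^sup>2) / 2" for x y :: real
    using sum_squares_bound[of x y] by simp
  have "slice a j \<bullet> transfer eps A (h (Suc j)) (slice a (Suc j)) \<le> r * (((?t j)\<^sup>2 + (?t (Suc j))\<^sup>2) / 2)"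
    if "j < n" for j
  proof -
    have "slice a j \<bullet> transfer eps A (h (Suc j)) (slice a (Suc j)) \<le> ?t j * (r * ?t (Suc j))"
      using that by (intro order_trans[OF norm_cauchy_schwarz] mult_left_mono contr) auto
    also have "\<dots> = r * (?t j * ?t (Suc j))" by simp
    also have "\<dots> \<le> r * (((?t j)\<^sup>2 + (?t (Suc j))\<^sup>2) / 2)"
      using r amgm by (intro mult_left_mono) auto
    finally show ?thesis .
  qed
  then have "(\<Sum>j<n. slice a j \<bullet> transfer eps A (h (Suc j)) (slice a (Suc j)))
      \<le> (\<Sum>j<n. r * (((?t j)\<^sup>2 + (?t (Suc j))\<^sup>2) / 2))"
    by (intro sum_mono) auto
  also have "\<dots> = r / 2 * ((\<Sum>j<n. (?t j)\<^sup>2) + (\<Sum>j<n. (?t (Suc j))\<^sup>2))"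
    by (simp add: sum_distrib_left[symmetric] sum_divide_distrib[symmetric] sum.distrib)
  also have "(\<Sum>j<n. (?t j)\<^sup>2) = ?T - (?t n)\<^sup>2"
    by (simp add: lessThan_Suc_atMost[symmetric])
  also have "(\<Sum>j<n. (?t (Suc j))\<^sup>2) = ?T - (?t 0)\<^sup>2"
    by (simp add: lessThan_Suc_atMost[symmetric] sum.lessThan_Suc_shift del: sum.lessThan_Suc)
  finally have 1: "(\<Sum>j<n. slice a j \<bullet> transfer eps A (h (Suc j)) (slice a (Suc j)))
      \<le> r / 2 * (?T - (?t n)\<^sup>2 + (?T - (?t 0)\<^sup>2))" .
  have 2: "slice a n \<bullet> slice a 0 \<le> ((?t n)\<^sup>2 + (?t 0)\<^sup>2) / 2"
    by (rule order_trans[OF norm_cauchy_schwarz amgm])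
  \<comment> \<open>\<open>n \<ge> 1\<close> makes 0 and \<open>n\<close> distinct, so both end
    terms occur in the full sum.\<close>
  have "(\<Sum>j\<in>{0, n}. (?t j)\<^sup>2) \<le> ?T"
    by (intro sum_mono2) auto
  then have 3: "(?t n)\<^sup>2 + (?t 0)\<^sup>2 \<le> ?T" using n by simp
  have "(\<Sum>p\<in>XT n. (norm (a p))\<^sup>2) = ?T"
    by (simp add: sum_XT norm_vec_def L2_set_def sum_nonneg)
  then have "(1 - r) / 2 * (\<Sum>p\<in>XT n. (norm (a p))\<^sup>2) = (1 - r) * ?T - (1 - r) / 2 * ?T"
    by (simp add: diff_divide_distrib left_diff_distrib)
  also have "\<dots> \<le> (1 - r) * ?T - (1 - r) / 2 * ((?t n)\<^sup>2 + (?t 0)\<^sup>2)"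
    using r by (intro diff_left_mono mult_left_mono 3) simp
  also have "\<dots> = ?T - r / 2 * (?T - (?t n)\<^sup>2 + (?T - (?t 0)\<^sup>2)) - ((?t n)\<^sup>2 + (?t 0)\<^sup>2) / 2"
    by (simp add: left_diff_distrib distrib_left right_diff_distrib diff_divide_distrib add_divide_distrib)
  also have "\<dots> \<le> Re (quadform (XT n) (Kmat n eps A h) a)"
    unfolding Re_quadform_Kmat using 1 2 by linarith
  finally show ?thesis .
qed

section \<open>Gaussian integrals, measurability and Tonelli\<close>

lemma nn_integral_gaussian_finite:
  fixes c :: real
  assumes "0 < c"
  shows "(\<integral>\<^sup>+x. ennreal (exp (- c * x\<^sup>2)) \<partial>lborel) < \<infinity>"
proof -
  define \<sigma> where "\<sigma> = sqrt (1 / (2 * c))"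
  have \<sigma>: "\<sigma>\<^sup>2 = 1 / (2 * c)" "0 < \<sigma>" using assms by (auto simp: \<sigma>_def)
  have "exp (- c * x\<^sup>2) = sqrt (2 * pi * \<sigma>\<^sup>2) * normal_density 0 \<sigma> x" for x
    using assms \<sigma> by (simp add: normal_density_def)
  then have "integrable lborel (\<lambda>x. exp (- c * x\<^sup>2))"
    using \<sigma> by simp
  then show ?thesis by (simp add: integrable_iff_bounded)
qed

text \<open>The integrand factorises over the real and imaginary parts, the two coordinates of
  \<open>Basis\<close>.\<close>

lemma nn_integral_complex_gaussian_finite:
  fixes c :: real
  assumes "0 < c"
  shows "(\<integral>\<^sup>+z. ennreal (exp (- c * (norm (z::complex))\<^sup>2)) \<partial>lborel) < \<infinity>"
proof -
  have "ennreal (exp (- c * (norm z)\<^sup>2)) = (\<Prod>b\<in>Basis. ennreal (exp (- c * (z \<bullet> b)\<^sup>2)))" for z :: complex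
  proof -
    have "(norm z)\<^sup>2 = (\<Sum>b\<in>Basis. (z \<bullet> b)\<^sup>2)"
      by (simp add: norm_eq_sqrt_inner euclidean_inner[of z z] power2_eq_square[symmetric] sum_nonneg)
    then show ?thesis
      by (simp add: prod_ennreal exp_sum[symmetric] sum_distrib_left sum_negf[symmetric] del: Basis_complex_def)
  qed
  then have "(\<integral>\<^sup>+z. ennreal (exp (- c * (norm (z::complex))\<^sup>2)) \<partial>lborel)
      = (\<Prod>b\<in>(Basis::complex set). \<integral>\<^sup>+x. ennreal (exp (- c * x\<^sup>2)) \<partial>lborel)"
    by (simp only:) (rule nn_integral_lborel_prod, auto)
  also have "\<dots> < \<infinity>"
    using nn_integral_gaussian_finite[OF assms]
    by (simp add: power_less_top_ennreal del: Basis_complex_def)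
  finally show ?thesis .
qed

text \<open>Required for the product measure \<open>Da\<close> and for exchanging the order of
  integration.\<close>

lemma sigma_finite_density_complex: "sigma_finite_measure (density (lborel::complex measure) (\<lambda>_. ennreal (1 / pi)))"
  by (subst sigma_finite_measure.sigma_finite_iff_density_finite[OF sigma_finite_lborel]) auto

lemma sigma_finite_Da: "sigma_finite_measure (Da n :: (nat \<times> 'x::finite \<Rightarrow> complex) measure)"
proof -
  interpret finite_product_sigma_finite "\<lambda>_. density (lborel::complex measure) (\<lambda>_. ennreal (1 / pi))" "XT n :: (nat \<times> 'x) set"
    by (intro finite_product_sigma_finite.intro product_sigma_finite.intro
        finite_product_sigma_finite_axioms.intro sigma_finite_density_complex finite_XT)
  show ?thesis unfolding Da_def by (rule sigma_finite_measure_axioms)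
qed

lemma nn_integral_Da_gaussian_finite:
  fixes c :: real
  assumes "0 < c"
  shows "(\<integral>\<^sup>+a. ennreal (exp (- c * (\<Sum>p\<in>XT n. (norm (a p))\<^sup>2))) \<partial>(Da n :: (nat \<times> 'x::finite \<Rightarrow> complex) measure)) < \<infinity>"
proof -
  let ?M = "density (lborel::complex measure) (\<lambda>_. ennreal (1 / pi))"
  let ?g = "\<lambda>z::complex. ennreal (exp (- c * (norm z)\<^sup>2))"
  interpret product_sigma_finite "\<lambda>_::nat \<times> 'x. ?M"
    by (intro product_sigma_finite.intro sigma_finite_density_complex)
  have "(\<integral>\<^sup>+a. ennreal (exp (- c * (\<Sum>p\<in>XT n. (norm (a p))\<^sup>2))) \<partial>(Da n :: (nat \<times> 'x \<Rightarrow> complex) measure))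
     = (\<integral>\<^sup>+a. (\<Prod>p\<in>XT n. ?g (a p)) \<partial>(Da n :: (nat \<times> 'x \<Rightarrow> complex) measure))"
    by (simp add: prod_ennreal exp_sum[symmetric] sum_distrib_left sum_negf[symmetric])
  also have "\<dots> = (\<Prod>p\<in>(XT n :: (nat \<times> 'x) set). \<integral>\<^sup>+z. ?g z \<partial>?M)"
    unfolding Da_def by (rule product_nn_integral_prod) auto
  also have "(\<integral>\<^sup>+z. ?g z \<partial>?M) = ennreal (1 / pi) * (\<integral>\<^sup>+z. ?g z \<partial>lborel)"
    by (subst nn_integral_density) (auto simp: nn_integral_cmult)
  also have "(\<Prod>p\<in>(XT n :: (nat \<times> 'x) set). \<dots>) < \<infinity>"
    using nn_integral_complex_gaussian_finite[OF assms]
    by (simp add: power_less_top_ennreal ennreal_mult_less_top)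
  finally show ?thesis .
qed

lemma Kmat_quadform_measurable:
  fixes M :: "('x::finite \<Rightarrow> real) measure"
  assumes M: "sets M = sets (PiM UNIV (\<lambda>_. borel))"
  shows "(\<lambda>(h, a). exp (- quadform (XT n) (Kmat n eps A (\<lambda>j x. complex_of_real (h j x))) a))
    \<in> borel_measurable (PiM {1..n} (\<lambda>_. M) \<Otimes>\<^sub>M Da n)"
proof -
  let ?P = "PiM {1..n} (\<lambda>_. M) \<Otimes>\<^sub>M (Da n :: (nat \<times> 'x \<Rightarrow> complex) measure)"
  have ev: "(\<lambda>\<omega>. \<omega> x) \<in> borel_measurable M" for x :: 'x
    unfolding measurable_cong_sets[OF M refl] by simp
  have h: "(\<lambda>w. fst w j x) \<in> borel_measurable ?P" if "1 \<le> j" "j \<le> n" for j x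
  proof -
    have "(\<lambda>w. fst w j) \<in> measurable ?P M"
      using that by (intro measurable_compose[OF measurable_fst] measurable_component_singleton) auto
    from measurable_compose[OF this ev] show ?thesis .
  qed
  have a: "(\<lambda>w. snd w p) \<in> borel_measurable ?P" if "p \<in> XT n" for p :: "nat \<times> 'x"
  proof -
    have "(\<lambda>a. a p) \<in> measurable (Da n) (density lborel (\<lambda>_. ennreal (1 / pi)))"
      unfolding Da_def using that by (rule measurable_component_singleton)
    then have "(\<lambda>a. a p) \<in> borel_measurable (Da n)" by simp
    then show ?thesis by (rule measurable_compose[OF measurable_snd])
  qed
  have K: "(\<lambda>w. Kmat n eps A (\<lambda>j x. complex_of_real (fst w j x)) p q) \<in> borel_measurable ?P"
    if "p \<in> XT n" "q \<in> XT n" for p q :: "nat \<times> 'x"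
  proof -
    obtain j x j' x' where pq: "p = (j, x)" "q = (j', x')" by (cases p; cases q)
    show ?thesis
    proof (cases "j' = j + 1")
      case True
      \<comment> \<open>From \<open>j' = j + 1\<close> and \<open>q \<in> XT n\<close> follows
        \<open>1 \<le> j' \<le> n\<close>, exactly the range of time coordinates carried by the
        product measure of the fields.\<close>
      then have "(\<lambda>w. fst w j' x') \<in> borel_measurable ?P"
        using that pq by (intro h) auto
      then have phase: "(\<lambda>w. exp (\<i> * complex_of_real (sqrt eps) * complex_of_real (fst w j' x'))) \<in> borel_measurable ?P"
        by (rule measurable_compose) (intro borel_measurable_continuous_onI continuous_intros)
      show ?thesis
        unfolding pq Kmat_def prod.case if_P[OF True]
        by (intro borel_measurable_diff borel_measurable_times borel_measurable_const phase)
    next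
      case False
      show ?thesis
        unfolding pq Kmat_def prod.case if_not_P[OF False] by (rule borel_measurable_const)
    qed
  qed
  have cnj_a: "(\<lambda>w. cnj (snd w p)) \<in> borel_measurable ?P" if "p \<in> XT n" for p :: "nat \<times> 'x"
    by (rule measurable_compose[OF a[OF that]])
       (intro borel_measurable_continuous_onI continuous_intros)
  have Q: "(\<lambda>w. quadform (XT n) (Kmat n eps A (\<lambda>j x. complex_of_real (fst w j x))) (snd w))
      \<in> borel_measurable ?P"
    unfolding quadform_def by (intro borel_measurable_sum borel_measurable_times K a cnj_a)
  have "(\<lambda>w. exp (- quadform (XT n) (Kmat n eps A (\<lambda>j x. complex_of_real (fst w j x))) (snd w)))
      \<in> borel_measurable ?P"
    by (rule measurable_compose[OF Q]) (intro borel_measurable_continuous_onI continuous_intros)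
  then show ?thesis by (simp add: split_def)
qed

text \<open>The Gaussian bound in \<open>a\<close> is uniform in \<open>h\<close>, so after Tonelli
  the integral over the probability measure of the fields contributes a factor 1.\<close>

lemma Kmat_gaussian_integrable:
  fixes M :: "('x::finite \<Rightarrow> real) measure" and A :: "'x cmat"
  assumes A: "hermitian A" and pos: "0 < e_min A" and eps: "0 < eps" and n: "1 \<le> n"
    and M: "prob_space M" "sets M = sets (PiM UNIV (\<lambda>_. borel))"
  shows "integrable (PiM {1..n} (\<lambda>_. M) \<Otimes>\<^sub>M Da n)
     (\<lambda>(h, a). exp (- quadform (XT n) (Kmat n eps A (\<lambda>j x. complex_of_real (h j x))) a))"
proof -
  let ?H = "PiM {1..n} (\<lambda>_. M)"
  let ?D = "Da n :: (nat \<times> 'x \<Rightarrow> complex) measure"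
  interpret H: prob_space ?H using M(1) by (intro prob_space_PiM)
  interpret D: sigma_finite_measure ?D by (rule sigma_finite_Da)
  define r where "r = exp (- eps * e_min A)"
  have r: "0 < r" "r < 1" using eps pos by (auto simp: r_def)
  define c where "c = (1 - r) / 2"
  have c: "0 < c" using r by (simp add: c_def)
  let ?F = "\<lambda>h a. exp (- quadform (XT n) (Kmat n eps A (\<lambda>j x. complex_of_real (h j x))) a)"
  let ?g = "\<lambda>a. ennreal (exp (- c * (\<Sum>p\<in>XT n. (norm (a p))\<^sup>2)))"
  have contr: "norm (transfer eps A (\<lambda>x. complex_of_real (h j x)) f) \<le> r * norm f" for h j f
    using norm_transfer_le[OF A, of eps "\<lambda>x. complex_of_real (h j x)" 0 f] eps by (simp add: r_def)
  have bound: "ennreal (norm (?F h a)) \<le> ?g a" for h :: "nat \<Rightarrow> 'x \<Rightarrow> real" and a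
    using Re_quadform_Kmat_ge[where h = "\<lambda>j x. complex_of_real (h j x)" and a = a and r = r and A = A, OF _ _ n contr[of h]] r
    by (intro ennreal_leI) (simp add: c_def)
  note meas = Kmat_quadform_measurable[OF M(2), of n eps A]
  have "(\<integral>\<^sup>+w. ennreal (norm ((\<lambda>(h, a). ?F h a) w)) \<partial>(?H \<Otimes>\<^sub>M ?D))
      = (\<integral>\<^sup>+h. \<integral>\<^sup>+a. ennreal (norm (?F h a)) \<partial>?D \<partial>?H)"
    using D.nn_integral_fst[of "\<lambda>w. ennreal (norm ((\<lambda>(h, a). ?F h a) w))" ?H]
      measurable_compose[OF meas borel_measurable_norm]
    by (simp add: measurable_compose[OF _ measurable_ennreal])
  also have "\<dots> \<le> (\<integral>\<^sup>+h. \<integral>\<^sup>+a. ?g a \<partial>?D \<partial>?H)"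
    by (intro nn_integral_mono bound)
  also have "\<dots> = (\<integral>\<^sup>+a. ?g a \<partial>?D)"
    by (simp only: nn_integral_const H.emeasure_space_1 mult_1_right)
  also have "\<dots> < \<infinity>" by (rule nn_integral_Da_gaussian_finite[OF c])
  finally show ?thesis using meas by (simp add: integrable_iff_bounded)
qed

section \<open>Analyticity\<close>

text \<open>The width is a parameter because uniform bounds hold only on strips strictly narrower
  than the critical one. Slices outside \<open>1..n\<close> are unconstrained, and the entries of
  \<open>Kmat\<close> between points of \<open>XT n\<close> do not read them.\<close>

definition strip :: "nat \<Rightarrow> real \<Rightarrow> (nat \<Rightarrow> 'x \<Rightarrow> complex) set" where
  "strip n b = {h. \<forall>j\<in>{1..n}. \<forall>x. \<bar>Im (h j x)\<bar> < b}"

text \<open>Finitely many strict inequalities leave some room. Inserting 0 keeps the set under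
  \<open>Max\<close> nonempty.\<close>

lemma strip_smaller_width:
  fixes h :: "nat \<Rightarrow> 'x::finite \<Rightarrow> complex"
  assumes "h \<in> strip n b" "0 < b"
  obtains c where "c < b" "h \<in> strip n c"
proof -
  let ?B = "insert 0 ((\<lambda>(j, x). \<bar>Im (h j x)\<bar>) ` ({1..n} \<times> UNIV))"
  have "Max ?B < b"
    using assms by (subst Max_less_iff) (auto simp: strip_def)
  then obtain c where c: "Max ?B < c" "c < b" using dense by blast
  have "\<bar>Im (h j x)\<bar> < c" if "j \<in> {1..n}" for j x
  proof -
    have "\<bar>Im (h j x)\<bar> \<le> Max ?B"
      using that by (intro Max_ge) (auto simp: image_iff)
    with c(1) show ?thesis by (rule le_less_trans[rotated])
  qed
  then have "h \<in> strip n c" by (simp add: strip_def)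
  with c show thesis using that by blast
qed

lemma continuous_on_coordinate: "continuous_on D (\<lambda>h :: nat \<Rightarrow> 'x \<Rightarrow> complex. h j x)"
  by (rule continuous_on_product_then_coordinatewise[OF
        continuous_on_product_then_coordinatewise[OF continuous_on_id]])

text \<open>Only finitely many coordinates are constrained, so the condition is open in the product
  topology on fields.\<close>

lemma eventually_strip:
  fixes h0 :: "nat \<Rightarrow> 'x::finite \<Rightarrow> complex"
  assumes "h0 \<in> strip n c"
  shows "\<forall>\<^sub>F h in at h0 within D. h \<in> strip n c"
proof -
  have "\<forall>\<^sub>F h in at h0 within D. \<bar>Im (h j x)\<bar> < c" if "j \<in> {1..n}" for j x
  proof (rule order_tendstoD(2))
    have "((\<lambda>h. h j x) \<longlongrightarrow> h0 j x) (at h0 within UNIV)"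
      using continuous_on_coordinate[of UNIV j x] unfolding continuous_on_def by blast
    then have "((\<lambda>h. h j x) \<longlongrightarrow> h0 j x) (at h0 within D)"
      by (rule tendsto_within_subset) simp
    then show "((\<lambda>h. \<bar>Im (h j x)\<bar>) \<longlongrightarrow> \<bar>Im (h0 j x)\<bar>) (at h0 within D)"
      by (intro tendsto_rabs tendsto_Im)
    show "\<bar>Im (h0 j x)\<bar> < c" using assms that by (auto simp: strip_def)
  qed
  then show ?thesis
    by (simp add: strip_def eventually_ball_finite_distrib eventually_all_finite)
qed

lemma continuous_on_Kmat: "continuous_on D (\<lambda>h. Kmat n eps A h p q)"
proof -
  obtain j x j' x' where pq: "p = (j, x)" "q = (j', x')" by (cases p; cases q)
  have "continuous_on D (\<lambda>h. exp (\<i> * complex_of_real (sqrt eps) * h j' x'))"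
    by (intro continuous_intros continuous_on_coordinate)
  then show ?thesis
    unfolding pq Kmat_def prod.case
    by (cases "j' = j + 1") (auto intro!: continuous_on_diff continuous_on_minus continuous_on_mult_left continuous_on_const)
qed

lemma holomorphic_on_Kmat:
  assumes "\<And>j x. (\<lambda>z. \<gamma> z j x) holomorphic_on Z"
  shows "(\<lambda>z. Kmat n eps A (\<gamma> z) p q) holomorphic_on Z"
proof -
  obtain j x j' x' where pq: "p = (j, x)" "q = (j', x')" by (cases p; cases q)
  have "(\<lambda>z. exp (\<i> * complex_of_real (sqrt eps) * \<gamma> z j' x')) holomorphic_on Z"
    by (intro holomorphic_intros assms)
  then show ?thesis
    unfolding pq Kmat_def prod.case
    by (cases "j' = j + 1") (auto intro!: holomorphic_on_diff holomorphic_on_minus holomorphic_on_mult holomorphic_on_const)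
qed

lemma Gcov_inverse_on_strip:
  fixes A :: "('x::finite) cmat"
  assumes A: "pos_def A" and eps: "0 < eps" and n: "1 \<le> n"
    and h: "h \<in> strip n (sqrt eps * e_min A)"
  shows "inverse_on (XT n) (Kmat n eps A h) (Gcov n eps A h)"
proof -
  have herm: "hermitian A" using A by (simp add: pos_def_def)
  have "0 < sqrt eps * e_min A" using eps e_min_pos[OF A] by simp
  then obtain c where c: "c < sqrt eps * e_min A" "h \<in> strip n c"
    using strip_smaller_width[OF h] by blast
  then have "\<bar>Im (h j x)\<bar> \<le> c" if "1 \<le> j" "j \<le> n" for j x
    using that by (simp add: strip_def less_imp_le)
  then show ?thesis by (rule Kmat_inverse_on(1)[OF herm eps n _ c(1)])
qed

text \<open>Fields near \<open>h0\<close> stay in a narrower strip of width \<open>c\<close> around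
  the real fields, where one bound serves all of them; this is the local boundedness needed for
  continuity of the inverse.\<close>

lemma continuous_on_Gcov:
  fixes A :: "('x::finite) cmat"
  assumes A: "pos_def A" and eps: "0 < eps" and n: "1 \<le> n" and pq: "p \<in> XT n" "q \<in> XT n"
  shows "continuous_on (strip n (sqrt eps * e_min A)) (\<lambda>h. Gcov n eps A h p q)"
proof (rule continuous_on_inverse_on[where M = "Kmat n eps A", OF finite_XT pq])
  fix h0 :: "nat \<Rightarrow> 'x \<Rightarrow> complex"
  assume h0: "h0 \<in> strip n (sqrt eps * e_min A)"
  have herm: "hermitian A" using A by (simp add: pos_def_def)
  have "0 < sqrt eps * e_min A" using eps e_min_pos[OF A] by simp
  then obtain c where c: "c < sqrt eps * e_min A" "h0 \<in> strip n c"
    using strip_smaller_width[OF h0] by blast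
  define s where "s = exp ((sqrt eps * c - eps * e_min A) / 2)"
  have "norm (Gcov n eps A h r t) \<le> 1 / s ^ n / (1 - s)"
    if "h \<in> strip n c" "r \<in> XT n" "t \<in> XT n" for h r t
    unfolding s_def using that
    by (intro Kmat_inverse_on(4)[OF herm eps n _ c(1)]) (auto simp: strip_def less_imp_le)
  then have "\<forall>\<^sub>F h in at h0 within strip n (sqrt eps * e_min A).
      \<forall>r\<in>XT n. \<forall>t\<in>XT n. norm (Gcov n eps A h r t) \<le> 1 / s ^ n / (1 - s)"
    by (intro eventually_mono[OF eventually_strip[OF c(2)]]) blast
  then show "\<exists>C. \<forall>\<^sub>F h in at h0 within strip n (sqrt eps * e_min A).
      \<forall>r\<in>XT n. \<forall>t\<in>XT n. norm (Gcov n eps A h r t) \<le> C" by (rule exI)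
qed (use Gcov_inverse_on_strip[OF A eps n] continuous_on_Kmat in auto)

text \<open>Along a single complex coordinate the entries of \<open>Kmat\<close> are holomorphic.
  The continuity needed for the inverse is the joint continuity of \<open>Gcov\<close>, restricted
  to that line.\<close>

lemma analytic_several_Gcov:
  fixes A :: "('x::finite) cmat"
  assumes A: "pos_def A" and eps: "0 < eps" and n: "1 \<le> n" and pq: "p \<in> XT n" "q \<in> XT n"
  shows "analytic_several I (strip n (sqrt eps * e_min A)) (\<lambda>h. Gcov n eps A h p q)"
proof -
  let ?D = "strip n (sqrt eps * e_min A) :: (nat \<Rightarrow> 'x \<Rightarrow> complex) set"
  have "(\<lambda>z. Gcov n eps A (h(j := (h j)(x := z))) p q) holomorphic_on {z. h(j := (h j)(x := z)) \<in> ?D}"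
    for h j x
  proof (rule holomorphic_on_inverse_on[where M = "\<lambda>z. Kmat n eps A (h(j := (h j)(x := z)))", OF finite_XT pq])
    let ?\<gamma> = "\<lambda>z. h(j := (h j)(x := z))"
    let ?Z = "{z. ?\<gamma> z \<in> ?D}"
    have coord: "(\<lambda>z. ?\<gamma> z i y) holomorphic_on ?Z" for i y
      by (cases "i = j"; cases "y = x") (simp_all add: holomorphic_on_ident)
    show "(\<lambda>z. Kmat n eps A (?\<gamma> z) r s) holomorphic_on ?Z" for r s
      by (rule holomorphic_on_Kmat[OF coord])
    have "continuous_on ?Z ?\<gamma>"
      using holomorphic_on_imp_continuous_on[OF coord]
      by (intro continuous_on_coordinatewise_then_product)
    then show "continuous_on ?Z (\<lambda>z. Gcov n eps A (?\<gamma> z) r s)" if "r \<in> XT n" "s \<in> XT n" for r s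
      by (rule continuous_on_compose2[OF continuous_on_Gcov[OF A eps n that]]) auto
  qed (rule Gcov_inverse_on_strip[OF A eps n], simp)
  then show ?thesis
    unfolding analytic_several_def using continuous_on_Gcov[OF assms] by auto
qed

section \<open>Convergence, invertibility, uniform bound, analyticity and domination
  combined\<close>

theorem theorem8p1:
  fixes E :: "('x::finite) cmat" and v :: "'x \<Rightarrow> 'x \<Rightarrow> real"
    and mu \<beta> :: real and n\<tau> :: nat and mu_v :: "('x \<Rightarrow> real) measure"
  assumes E_herm: "hermitian E"
    and v_sym: "\<forall>x y. v x y = v y x"
    and v_nonneg: "\<forall>\<xi>::'x \<Rightarrow> real. 0 \<le> (\<Sum>x\<in>UNIV. \<Sum>y\<in>UNIV. \<xi> x * v x y * \<xi> y)"
    and beta_pos: "\<beta> > 0"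
    and ntau_pos: "n\<tau> \<ge> 1"
    and gauss: "centered_gaussian v mu_v"
    and Emu_pos: "pos_def (Emu E mu)"
  shows
    "integrable (PiM {1..n\<tau>} (\<lambda>_. mu_v) \<Otimes>\<^sub>M Da n\<tau>)
       (\<lambda>(h, a). exp (- quadform (XT n\<tau>)
            (Kmat n\<tau> (\<beta> / real n\<tau>) (Emu E mu) (\<lambda>j x. complex_of_real (h j x))) a))
   \<and> (\<forall>h::nat \<Rightarrow> 'x \<Rightarrow> real.
        invertible_on (XT n\<tau>) (Kmat n\<tau> (\<beta> / real n\<tau>) (Emu E mu) (\<lambda>j x. complex_of_real (h j x))))
   \<and> (\<exists>C. \<forall>h::nat \<Rightarrow> 'x \<Rightarrow> real.
        opnorm_on (XT n\<tau>) (Gcov n\<tau> (\<beta> / real n\<tau>) (Emu E mu) (\<lambda>j x. complex_of_real (h j x))) \<le> C)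
   \<and> (let D = {h :: nat \<Rightarrow> 'x \<Rightarrow> complex. \<forall>j\<in>{1..n\<tau>}. \<forall>x.
                 \<bar>Im (h j x)\<bar> < sqrt (\<beta> / real n\<tau>) * e_min (Emu E mu)}
      in (\<forall>h\<in>D. invertible_on (XT n\<tau>) (Kmat n\<tau> (\<beta> / real n\<tau>) (Emu E mu) h))
         \<and> (\<forall>p\<in>XT n\<tau>. \<forall>q\<in>XT n\<tau>.
              analytic_several ({1..n\<tau>} \<times> UNIV) D (\<lambda>h. Gcov n\<tau> (\<beta> / real n\<tau>) (Emu E mu) h p q)))
   \<and> (generates_stochastic (Emu E mu) \<longrightarrow>
        (\<forall>h::nat \<Rightarrow> 'x \<Rightarrow> real. \<forall>j j' x x'. j \<le> j' \<and> j' \<le> n\<tau> \<longrightarrow>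
           Gcov n\<tau> (\<beta> / real n\<tau>) (Emu E mu) (\<lambda>_ _. 0) (j, x) (j', x') \<in> \<real> \<and>
           cmod (Gcov n\<tau> (\<beta> / real n\<tau>) (Emu E mu) (\<lambda>j x. complex_of_real (h j x)) (j, x) (j', x'))
             \<le> Re (Gcov n\<tau> (\<beta> / real n\<tau>) (Emu E mu) (\<lambda>_ _. 0) (j, x) (j', x'))))"
proof -
  let ?A = "Emu E mu" and ?eps = "\<beta> / real n\<tau>"
  have herm: "hermitian ?A" using Emu_pos by (simp add: pos_def_def)
  have e: "0 < e_min ?A" by (rule e_min_pos[OF Emu_pos])
  have eps: "0 < ?eps" using beta_pos ntau_pos by simp
  have M: "prob_space mu_v" "sets mu_v = sets (PiM UNIV (\<lambda>_. borel))"
    using gauss by (auto simp: centered_gaussian_def)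
  have width: "0 < sqrt ?eps * e_min ?A" using e eps by simp
  have inv: "inverse_on (XT n\<tau>) (Kmat n\<tau> ?eps ?A h) (Gcov n\<tau> ?eps ?A h)"
    if "h \<in> strip n\<tau> (sqrt ?eps * e_min ?A)" for h
    by (rule Gcov_inverse_on_strip[OF Emu_pos eps ntau_pos that])
  have real: "(\<lambda>j x. complex_of_real (h j x)) \<in> strip n\<tau> (sqrt ?eps * e_min ?A)" for h :: "nat \<Rightarrow> 'x \<Rightarrow> real"
    using width by (simp add: strip_def)
  \<comment> \<open>The contraction rate for width \<open>c = 0\<close>, the case of real fields;
    the factor 0 is kept so that \<open>s\<close> has the form used in
    \<open>Kmat_inverse_on\<close>.\<close>
  define s where "s = exp ((sqrt ?eps * 0 - ?eps * e_min ?A) / 2)"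
  have bound: "norm (Gcov n\<tau> ?eps ?A (\<lambda>j x. complex_of_real (h j x)) p q) \<le> 1 / s ^ n\<tau> / (1 - s)"
    if "p \<in> XT n\<tau>" "q \<in> XT n\<tau>" for h :: "nat \<Rightarrow> 'x \<Rightarrow> real" and p q
    unfolding s_def by (rule Kmat_inverse_on(4)[OF herm eps ntau_pos _ width that]) simp
  have D: "{h :: nat \<Rightarrow> 'x \<Rightarrow> complex. \<forall>j\<in>{1..n\<tau>}. \<forall>x. \<bar>Im (h j x)\<bar> < sqrt ?eps * e_min ?A}
      = strip n\<tau> (sqrt ?eps * e_min ?A)" by (simp add: strip_def)
  show ?thesis
    unfolding Let_def D
  proof (intro conjI allI impI ballI exI)
    show "integrable (PiM {1..n\<tau>} (\<lambda>_. mu_v) \<Otimes>\<^sub>M Da n\<tau>)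
       (\<lambda>(h, a). exp (- quadform (XT n\<tau>) (Kmat n\<tau> ?eps ?A (\<lambda>j x. complex_of_real (h j x))) a))"
      by (rule Kmat_gaussian_integrable[OF herm e eps ntau_pos M])
  next
    fix h :: "nat \<Rightarrow> 'x \<Rightarrow> real"
    show "invertible_on (XT n\<tau>) (Kmat n\<tau> ?eps ?A (\<lambda>j x. complex_of_real (h j x)))"
      using inv[OF real] unfolding invertible_on_def by blast
  next
    fix h :: "nat \<Rightarrow> 'x \<Rightarrow> real"
    show "opnorm_on (XT n\<tau>) (Gcov n\<tau> ?eps ?A (\<lambda>j x. complex_of_real (h j x)))
        \<le> sqrt (\<Sum>p\<in>(XT n\<tau> :: (nat \<times> 'x) set). (\<Sum>q\<in>(XT n\<tau> :: (nat \<times> 'x) set). 1 / s ^ n\<tau> / (1 - s))\<^sup>2)"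
      by (rule opnorm_on_le[OF finite_XT bound])
  next
    fix h :: "nat \<Rightarrow> 'x \<Rightarrow> complex"
    assume "h \<in> strip n\<tau> (sqrt ?eps * e_min ?A)"
    then show "invertible_on (XT n\<tau>) (Kmat n\<tau> ?eps ?A h)"
      using inv unfolding invertible_on_def by blast
  next
    fix p q :: "nat \<times> 'x"
    assume "p \<in> XT n\<tau>" "q \<in> XT n\<tau>"
    then show "analytic_several ({1..n\<tau>} \<times> UNIV) (strip n\<tau> (sqrt ?eps * e_min ?A)) (\<lambda>h. Gcov n\<tau> ?eps ?A h p q)"
      by (rule analytic_several_Gcov[OF Emu_pos eps ntau_pos])
  next
    fix h :: "nat \<Rightarrow> 'x \<Rightarrow> real" and j j' x x'
    assume "generates_stochastic ?A" "j \<le> j' \<and> j' \<le> n\<tau>"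
    then show "Gcov n\<tau> ?eps ?A (\<lambda>_ _. 0) (j, x) (j', x') \<in> \<real>"
      by (intro Gcov_dominated(1)[OF herm e eps ntau_pos]) auto
  next
    fix h :: "nat \<Rightarrow> 'x \<Rightarrow> real" and j j' x x'
    assume "generates_stochastic ?A" "j \<le> j' \<and> j' \<le> n\<tau>"
    then show "cmod (Gcov n\<tau> ?eps ?A (\<lambda>j x. complex_of_real (h j x)) (j, x) (j', x'))
        \<le> Re (Gcov n\<tau> ?eps ?A (\<lambda>_ _. 0) (j, x) (j', x'))"
      by (intro Gcov_dominated(2)[OF herm e eps ntau_pos]) auto
  qed
qed

end
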